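(* Let $M$ be a monoid and $S\subseteq M$ a generating subset with $1\in S$. (1) The assignment $\eta\mapsto(S,N'_\varphi)$ (with $\varphi$ the restriction of $\eta\mu$ to $S^2$) from factorability structures on $(M,S)$ to quadratic normalisations $(S,N)$ mod $1$ for $M$ such that the weak domino rule is valid for $\overline{N}$, and the assignment $(S,N)\mapsto\eta_N$ in the opposite direction, are well-defined and inverse to each other. (2) If $\eta$ is a factorability structure on $(M,S)$ and $(S,N)$ is the corresponding quadratic normalisation, then the associated normal forms are the same: $\mathrm{nf}_\eta(f)=\pi_1(N(w))$ for every $f\in M$ and every $S$-word $w$ representing $f$. (3) If $\eta$ is a factorability structure on $(M,S)$ and $(S,N)$ is the corresponding quadratic normalisation, then the rewriting systems $(S_+,R_\eta)$ and $(S,R_N)$ associated with them differ only by dummy letters $1$ preserving length in the latter: $R_\eta=\{(\pi_1(u),\pi_1(v)) : (u,v)\in R_N,\ \pi_1(u)\neq\pi_1(v)\}$.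
   Context: Notation. $\mu:M^2\to M$ is the multiplication, $S_+=S\setminus\{1\}$. $S^*$ is the free monoid over $S$; its elements are words $(s_1,\ldots,s_n)=s_1|\cdots|s_n$; $|w|$ is the length of a word; $\mathrm{ev}:S^*\to M$ is the evaluation homomorphism, and $w$ represents $f$ if $\mathrm{ev}(w)=f$. $\pi_1:S^*\to S_+^*$ deletes all occurrences of the letter $1$. For $f\in M$, $|f|$ is the minimal length of an $S$-word representing $f$ (so $|1|=0$). For a map $F$ defined on $A^k$ ($k\in\{1,2\}$) with values in $A^2$, $F_i$ applies $F$ to the $k$ consecutive entries of a word starting at position $i$ (counted from the left). Compositions are read with the rightmost map applied first. Factorability. A factorisation map for $(M,S)$ is a map $\eta=(\eta',\overline{\eta}):M\to M^2$ with $\eta(1)=(1,1)$ and, for every $f\ne1$: $\eta'(f)\in S_+$, $\eta'(f)\cdot\overline{\eta}(f)=f$, $|f|=|\eta'(f)|+|\overline{\eta}(f)|$. It is a factorability structure on $(M,S)$ if, with $F=\eta\circ\mu$, for every triple in $M^3$ either $F_1F_2F_1F_2$, $F_2F_1F_2$, $F_2F_1F_2F_1$ take the same value on it or each of these three maps strictly reduces the sum of the lengths of the entries. The $\eta$-normal form is $\mathrm{nf}_\eta(f)=\eta_{|f|-1}\cdots\eta_2\eta_1(f)$ for $f\neq1$, and $\mathrm{nf}_\eta(1)$ is the empty word. The rewriting system associated with $\eta$ is $(S_+,R_\eta)$, where $R_\eta$ consists of the rules $(s,t)\to\eta\mu(s,t)$ for all $s,t\in S_+$ with $\eta\mu(s,t)\neq(s,t)$;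 if $\overline{\eta}(st)=1$ the rule is interpreted as $(s,t)\to st$ (a one-letter word, or the empty word if $st=1$). The maps $N_\varphi$ and $N'_\varphi$. For $\varphi:S^2\to S^2$ and $w\in S^*$ put $T_\varphi(w)=\varphi_{|w|-1}\cdots\varphi_1(w)$ ($T_\varphi(w)=w$ if $|w|=1$). $N_\varphi:S^*\to S^*$ is defined recursively: $N_\varphi$ of the empty word is empty; $N_\varphi$ of a word containing $1$ equals $N_\varphi$ of the word with $1$ removed; for $s_1,\ldots,s_n\in S_+$, putting $v=T_\varphi(s_1|N_\varphi(s_2,\ldots,s_n))$, $N_\varphi(s_1,\ldots,s_n)=v$ if $v$ contains no $1$, and $=N_\varphi(v)$ otherwise. Then $N'_\varphi(w)=N_\varphi(w)|1^m$ with $m=|w|-|N_\varphi(w)|$. The quadratic normalisation corresponding to a factorability structure $\eta$ is $(S,N'_\varphi)$ with $\varphi$ the restriction of $\eta\mu$ to $S^2$. Normalisation. A normalisation is a pair $(A,N)$ with $N:A^*\to A^*$ length-preserving, identity on one-letter words, and $N(u|v|w)=N(u|N(v)|w)$ for all words $u,v,w$; $w$ is $N$-normal if $N(w)=w$; $\overline{N}$ is the restriction of $N$ to length-two words. $(A,N)$ is quadratic if a word is $N$-normal iff all its length-two factors are, and for each word $w$ there is a finite sequence of positions $(i_1,\ldots,i_k)$ with $N(w)=\overline{N}_{i_k}\cdots\overline{N}_{i_1}(w)$. $e\in A$ is $N$-neutral if $N(w|e)=N(e|w)=N(w)|e$ for all $w$. $(S,N)$ is a normalisation mod $1$ for $M$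 if $1\in S$ is $N$-neutral and $M$ is presented (via the inclusion $S\subseteq M$) by $\langle S\mid\{w=N(w):w\in S^*\}\cup\{1_S=1\}\rangle$, where $1_S$ is the letter $1$ of $S$. The rewriting system associated with a quadratic normalisation $(S,N)$ is $(S,R_N)$, where $R_N$ consists of the rules $s|t\to\overline{N}(s|t)$ for all $s,t\in S$ with $s|t$ not $N$-normal. Weak domino rule. It is valid for $G=\overline{N}$ if for all $r_1,r_2,r_1',r_2',s_0,s_1,s_2\in S$ with $G(s_0|r_1)=r_1'|s_1$, $G(s_1|r_2)=r_2'|s_2$ and none of $r_1',r_2',s_2$ equal to $1$: if $r_1|r_2$, $r_1'|s_1$, $r_2'|s_2$ are fixed points of $G$, then so is $r_1'|r_2'$. From normalisations to factorability. For a quadratic normalisation $(S,N)$ mod $1$ for $M$ with the weak domino rule valid for $\overline{N}$, put $\varphi=\overline{N}$ and define $\eta_N(1)=(1,1)$ and, for $f\ne1$, $\eta_N(f)=(r_1,\mathrm{ev}(r_2,\ldots,r_n))$ where $N_\varphi(w)=(r_1,\ldots,r_n)$ for any $S$-word $w$ representing $f$. *)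

theory Defs
  imports "HOL-Library.FuncSet" "HOL-Library.Sublist"
begin

(* The monoid M is the whole type. Words over S are the elements of lists S, the evaluation map is
   prod_list, and removeAll 1 deletes the letter 1 from a word. *)

definition word_length :: "'a::monoid_mult set \<Rightarrow> 'a \<Rightarrow> nat" where
  "word_length S f = (LEAST n. \<exists>w\<in>lists S. prod_list w = f \<and> length w = n)"

definition mult_pair :: "'a::times \<times> 'a \<Rightarrow> 'a" where
  "mult_pair p = fst p * snd p"

(* Positions count from 1, so that the k-th letter of w is w ! (k - 1). The two functions are
   meaningful only for 1 \<le> i \<le> length w and for 1 \<le> i < length w, respectively. *)

definition apply1_at :: "('a \<Rightarrow> 'a \<times> 'a) \<Rightarrow> nat \<Rightarrow> 'a list \<Rightarrow> 'a list" where
  "apply1_at h i w = take (i - 1) w @ (case h (w ! (i - 1)) of (a, b) \<Rightarrow> [a, b]) @ drop i w"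

definition apply2_at :: "('a \<times> 'a \<Rightarrow> 'a \<times> 'a) \<Rightarrow> nat \<Rightarrow> 'a list \<Rightarrow> 'a list" where
  "apply2_at h i w =
     take (i - 1) w @ (case h (w ! (i - 1), w ! i) of (a, b) \<Rightarrow> [a, b]) @ drop (i + 1) w"

definition factorisation_map :: "'a::monoid_mult set \<Rightarrow> ('a \<Rightarrow> 'a \<times> 'a) \<Rightarrow> bool" where
  "factorisation_map S \<eta> \<longleftrightarrow>
     \<eta> 1 = (1, 1) \<and>
     (\<forall>f. f \<noteq> 1 \<longrightarrow>
        fst (\<eta> f) \<in> S - {1} \<and>
        fst (\<eta> f) * snd (\<eta> f) = f \<and>
        word_length S f = word_length S (fst (\<eta> f)) + word_length S (snd (\<eta> f)))"

definition total_length :: "'a::monoid_mult set \<Rightarrow> 'a list \<Rightarrow> nat" where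
  "total_length S w = sum_list (map (word_length S) w)"

definition factorability_structure :: "'a::monoid_mult set \<Rightarrow> ('a \<Rightarrow> 'a \<times> 'a) \<Rightarrow> bool" where
  "factorability_structure S \<eta> \<longleftrightarrow>
     factorisation_map S \<eta> \<and>
     (\<forall>a b c.
        let t = [a, b, c];
            F1 = apply2_at (\<eta> \<circ> mult_pair) 1;
            F2 = apply2_at (\<eta> \<circ> mult_pair) 2;
            x = F1 (F2 (F1 (F2 t)));
            y = F2 (F1 (F2 t));
            z = F2 (F1 (F2 (F1 t)))
        in (x = y \<and> y = z) \<or>
           (total_length S x < total_length S t \<and>
            total_length S y < total_length S t \<and>
            total_length S z < total_length S t))"

(* fold applies the function at the first position of the list first. *)

definition eta_nf :: "'a::monoid_mult set \<Rightarrow> ('a \<Rightarrow> 'a \<times> 'a) \<Rightarrow> 'a \<Rightarrow> 'a list" where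
  "eta_nf S \<eta> f = (if f = 1 then [] else fold (apply1_at \<eta>) [1..<word_length S f] [f])"

definition eta_rules :: "'a::monoid_mult set \<Rightarrow> ('a \<Rightarrow> 'a \<times> 'a) \<Rightarrow> ('a list \<times> 'a list) set" where
  "eta_rules S \<eta> =
     {([s, t],
       if snd (\<eta> (s * t)) = 1 then (if s * t = 1 then [] else [s * t])
       else [fst (\<eta> (s * t)), snd (\<eta> (s * t))]) | s t.
      s \<in> S - {1} \<and> t \<in> S - {1} \<and> \<eta> (s * t) \<noteq> (s, t)}"

definition T_phi :: "('a \<times> 'a \<Rightarrow> 'a \<times> 'a) \<Rightarrow> 'a list \<Rightarrow> 'a list" where
  "T_phi \<phi> w = fold (apply2_at \<phi>) [1..<length w] w"

lemma length_apply2_at: "1 \<le> i \<Longrightarrow> i < length w \<Longrightarrow> length (apply2_at h i w) = length w"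
  by (auto simp: apply2_at_def split: prod.split)

lemma length_fold_apply2_at:
  "set is \<subseteq> {1..<length w} \<Longrightarrow> length (fold (apply2_at h) is w) = length w"
  by (induction "is" arbitrary: w) (auto simp: length_apply2_at)

lemma length_T_phi [simp]: "length (T_phi \<phi> w) = length w"
  by (simp add: T_phi_def length_fold_apply2_at)

function N_phi :: "('a::one \<times> 'a \<Rightarrow> 'a \<times> 'a) \<Rightarrow> 'a list \<Rightarrow> 'a list" where
  "N_phi \<phi> [] = []"
| "N_phi \<phi> (s # w) =
     (if 1 \<in> set (s # w) then N_phi \<phi> (removeAll 1 (s # w))
      else let v = T_phi \<phi> (s # N_phi \<phi> w) in if 1 \<in> set v then N_phi \<phi> v else v)"
  by pat_completeness auto

lemma N_phi_length_le:
  "N_phi_dom (\<phi>, w) \<Longrightarrow> length (N_phi \<phi> w) \<le> length (removeAll 1 w)"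
proof (induction \<phi> w rule: N_phi.pinduct)
  case (1 \<phi>)
  then show ?case by (simp add: N_phi.psimps)
next
  case (2 \<phi> s w)
  show ?case
  proof (cases "1 \<in> set (s # w)")
    case True
    then show ?thesis using 2 by (simp add: N_phi.psimps del: removeAll.simps)
  next
    case False
    let ?v = "T_phi \<phi> (s # N_phi \<phi> w)"
    have "length (N_phi \<phi> w) \<le> length w"
      using "2.IH"(2) False by simp
    then have v: "length ?v \<le> length (s # w)" by simp
    have eq: "N_phi \<phi> (s # w) = (if 1 \<in> set ?v then N_phi \<phi> ?v else ?v)"
      using False 2(1) by (simp add: N_phi.psimps Let_def)
    have "length (N_phi \<phi> ?v) \<le> length (removeAll 1 ?v)" if "1 \<in> set ?v"
      using "2.IH"(3)[OF False refl that] .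
    moreover have "length (removeAll 1 ?v) \<le> length ?v"
      by (rule length_removeAll_less_eq)
    moreover have "removeAll 1 (s # w) = s # w" using False by (simp add: removeAll_id)
    ultimately show ?thesis using v eq by (auto simp del: removeAll.simps)
  qed
qed

termination N_phi
proof (relation "measure (\<lambda>(\<phi>, w). 2 * length (removeAll 1 w) + (if 1 \<in> set w then 1 else 0))",
    goal_cases)
  case 1
  show ?case by simp
next
  case (2 \<phi> s w)
  then show ?case by (simp del: removeAll.simps)
next
  case (3 \<phi> s w)
  then show ?case by auto
next
  case (4 \<phi> s w v)
  have "length (N_phi \<phi> w) \<le> length w"
    using N_phi_length_le[OF 4(4)] length_removeAll_less_eq[of 1 w] by (rule le_trans)
  then have "length v \<le> length (s # w)" using 4(2) by simp
  moreover have "length (removeAll 1 v) < length v"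
    using 4(3) by (rule length_removeAll_less)
  ultimately show ?case using 4(1,3) by (simp del: removeAll.simps add: removeAll_id)
qed

definition N_phi' :: "('a::one \<times> 'a \<Rightarrow> 'a \<times> 'a) \<Rightarrow> 'a list \<Rightarrow> 'a list" where
  "N_phi' \<phi> w = N_phi \<phi> w @ replicate (length w - length (N_phi \<phi> w)) 1"

definition phi_of_eta :: "'a::monoid_mult set \<Rightarrow> ('a \<Rightarrow> 'a \<times> 'a) \<Rightarrow> 'a \<times> 'a \<Rightarrow> 'a \<times> 'a" where
  "phi_of_eta S \<eta> = restrict (\<eta> \<circ> mult_pair) (S \<times> S)"

definition N_of_eta :: "'a::monoid_mult set \<Rightarrow> ('a \<Rightarrow> 'a \<times> 'a) \<Rightarrow> 'a list \<Rightarrow> 'a list" where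
  "N_of_eta S \<eta> = N_phi' (phi_of_eta S \<eta>)"

(* A map N on words over A is represented by a total function on lists; only its values on lists A
   are relevant. *)

definition normalisation :: "'a set \<Rightarrow> ('a list \<Rightarrow> 'a list) \<Rightarrow> bool" where
  "normalisation A N \<longleftrightarrow>
     N \<in> lists A \<rightarrow> lists A \<and>
     (\<forall>w\<in>lists A. length (N w) = length w) \<and>
     (\<forall>a\<in>A. N [a] = [a]) \<and>
     (\<forall>u\<in>lists A. \<forall>v\<in>lists A. \<forall>w\<in>lists A. N (u @ v @ w) = N (u @ N v @ w))"

definition N_bar :: "('a list \<Rightarrow> 'a list) \<Rightarrow> 'a \<times> 'a \<Rightarrow> 'a \<times> 'a" where
  "N_bar N p = (let w = N [fst p, snd p] in (w ! 0, w ! 1))"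

definition quadratic_normalisation :: "'a set \<Rightarrow> ('a list \<Rightarrow> 'a list) \<Rightarrow> bool" where
  "quadratic_normalisation A N \<longleftrightarrow>
     normalisation A N \<and>
     (\<forall>w\<in>lists A. N w = w \<longleftrightarrow> (\<forall>s t. sublist [s, t] w \<longrightarrow> N [s, t] = [s, t])) \<and>
     (\<forall>w\<in>lists A. \<exists>is. set is \<subseteq> {1..<length w} \<and> N w = fold (apply2_at (N_bar N)) is w)"

definition neutral_letter :: "'a set \<Rightarrow> ('a list \<Rightarrow> 'a list) \<Rightarrow> 'a \<Rightarrow> bool" where
  "neutral_letter A N e \<longleftrightarrow>
     e \<in> A \<and> (\<forall>w\<in>lists A. N (w @ [e]) = N w @ [e] \<and> N (e # w) = N w @ [e])"

inductive word_congruence :: "'a set \<Rightarrow> ('a list \<times> 'a list) set \<Rightarrow> 'a list \<Rightarrow> 'a list \<Rightarrow> bool"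
  for A R where
  rel: "(x, y) \<in> R \<Longrightarrow> u \<in> lists A \<Longrightarrow> x \<in> lists A \<Longrightarrow> y \<in> lists A \<Longrightarrow> v \<in> lists A \<Longrightarrow>
    word_congruence A R (u @ x @ v) (u @ y @ v)"
| refl: "w \<in> lists A \<Longrightarrow> word_congruence A R w w"
| sym: "word_congruence A R v w \<Longrightarrow> word_congruence A R w v"
| trans: "word_congruence A R u v \<Longrightarrow> word_congruence A R v w \<Longrightarrow> word_congruence A R u w"

(* The monoid is presented by generators A and relations R via the inclusion of A: evaluation induces
   an isomorphism from the quotient of the free monoid by the congruence generated by R. *)

definition presented_by :: "'a::monoid_mult set \<Rightarrow> ('a list \<times> 'a list) set \<Rightarrow> bool" where
  "presented_by A R \<longleftrightarrow>
     prod_list ` lists A = (UNIV :: 'a set) \<and>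
     (\<forall>u\<in>lists A. \<forall>v\<in>lists A. prod_list u = prod_list v \<longleftrightarrow> word_congruence A R u v)"

definition normalisation_mod_1 :: "'a::monoid_mult set \<Rightarrow> ('a list \<Rightarrow> 'a list) \<Rightarrow> bool" where
  "normalisation_mod_1 S N \<longleftrightarrow>
     normalisation S N \<and>
     neutral_letter S N 1 \<and>
     presented_by S ({(w, N w) | w. w \<in> lists S} \<union> {([1], [])})"

definition normalisation_rules :: "'a set \<Rightarrow> ('a list \<Rightarrow> 'a list) \<Rightarrow> ('a list \<times> 'a list) set" where
  "normalisation_rules S N = {([s, t], N [s, t]) | s t. s \<in> S \<and> t \<in> S \<and> N [s, t] \<noteq> [s, t]}"

definition weak_domino_rule :: "'a::one set \<Rightarrow> ('a \<times> 'a \<Rightarrow> 'a \<times> 'a) \<Rightarrow> bool" where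
  "weak_domino_rule S G \<longleftrightarrow>
     (\<forall>r1\<in>S. \<forall>r2\<in>S. \<forall>r1'\<in>S. \<forall>r2'\<in>S. \<forall>s0\<in>S. \<forall>s1\<in>S. \<forall>s2\<in>S.
        G (s0, r1) = (r1', s1) \<and> G (s1, r2) = (r2', s2) \<and>
        r1' \<noteq> 1 \<and> r2' \<noteq> 1 \<and> s2 \<noteq> 1 \<and>
        G (r1, r2) = (r1, r2) \<and> G (r1', s1) = (r1', s1) \<and> G (r2', s2) = (r2', s2)
        \<longrightarrow> G (r1', r2') = (r1', r2'))"

definition weak_domino_normalisation :: "'a::monoid_mult set \<Rightarrow> ('a list \<Rightarrow> 'a list) \<Rightarrow> bool" where
  "weak_domino_normalisation S N \<longleftrightarrow>
     quadratic_normalisation S N \<and> normalisation_mod_1 S N \<and> weak_domino_rule S (N_bar N)"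

(* The value must not depend on the choice of the word representing f, and N_phi of that word must be
   nonempty for f \<noteq> 1; this is the predicate below. *)

definition eta_of_N :: "'a::monoid_mult set \<Rightarrow> ('a list \<Rightarrow> 'a list) \<Rightarrow> 'a \<Rightarrow> 'a \<times> 'a" where
  "eta_of_N S N f =
     (if f = 1 then (1, 1)
      else let r = N_phi (N_bar N) (SOME w. w \<in> lists S \<and> prod_list w = f)
           in (hd r, prod_list (tl r)))"

definition eta_of_N_well_defined :: "'a::monoid_mult set \<Rightarrow> ('a list \<Rightarrow> 'a list) \<Rightarrow> bool" where
  "eta_of_N_well_defined S N \<longleftrightarrow>
     (\<forall>v\<in>lists S. \<forall>w\<in>lists S. prod_list v = prod_list w \<longrightarrow>
        N_phi (N_bar N) v = N_phi (N_bar N) w) \<and>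
     (\<forall>w\<in>lists S. prod_list w \<noteq> 1 \<longrightarrow> N_phi (N_bar N) w \<noteq> [])"

end

(* Everything rests on computing nf (s f) from nf f = x1 | ... | xn for a letter s: sweep s through the
   word by T_phi. If no letter 1 is produced, the result is nf (s f).

   From eta to N: the axiom for (1, f, 1) makes neighbouring letters of a normal form stable, and for
   (s, f, 1) it gives eta (s f) = (x', t g), where eta f = (x, g) and eta (s x) = (x', t), unless the
   total length drops. Iterated, this is the sweep, so that N_phi w = nf (ev w). All properties of N
   follow, since N w depends only on ev w and the length of w.

   From N to eta: nf (ev w) is N w without its letters 1, and the weak domino rule makes the swept word
   N-normal. Let x and g be as above. Induction over |a| gives, for all a and f in M,
   eta (a f) = (eta' (a x), r g), r being the second component of eta (a x), if |a f| = |a| + |f|;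
   conversely, this length equality follows from |a x| = |a| + |x| and |r g| = |r| + |g|. Hence for a
   triple (a, b, c) with |a b c| = |a| + |b| + |c| all three composites in the axiom yield the first two
   letters of nf (a b c) and the remaining factor, and for any other triple all three of them lose
   length. *)

theory Submission
  imports Defs
begin

section \<open>Words\<close>

lemma prod_list_removeAll_one [simp]:
  "prod_list (removeAll 1 w) = prod_list (w :: 'a::monoid_mult list)"
  by (induction w) auto

lemma removeAll_one_replicate_one [simp]: "removeAll x (replicate n x) = []"
  by (induction n) auto

text \<open>Turns the condition on length-two factors in \<open>quadratic_normalisation\<close> into
  a predicate with a recursion along the word.\<close>

lemma all_sublist_pairs_iff_successively:
  "(\<forall>s t. sublist [s, t] w \<longrightarrow> P s t) \<longleftrightarrow> successively P w"
proof (induction w)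
  case (Cons a w)
  have "(\<forall>s t. sublist [s, t] (a # w) \<longrightarrow> P s t) \<longleftrightarrow>
      (w \<noteq> [] \<longrightarrow> P a (hd w)) \<and> (\<forall>s t. sublist [s, t] w \<longrightarrow> P s t)"
    by (cases w) (auto simp: sublist_Cons_right)
  then show ?case
    unfolding Cons.IH by (cases w) simp_all
qed auto

text \<open>Normal words will satisfy the hypothesis, so that a normal word is known from its
  letters other than 1 and its length.\<close>

lemma ones_at_end:
  fixes w :: "'a::one list"
  assumes "successively (\<lambda>a b. a = 1 \<longrightarrow> b = 1) w"
  shows "w = removeAll 1 w @ replicate (length w - length (removeAll 1 w)) 1"
  using assms
proof (induction w)
  case (Cons a w)
  then have w: "w = removeAll 1 w @ replicate (length w - length (removeAll 1 w)) 1"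
    by (cases w) auto
  show ?case
  proof (cases "a = 1")
    case True
    \<comment> \<open>By the equation for \<open>w\<close>, a remaining letter b \<noteq> 1 would be
      the head of \<open>w\<close>, directly after \<open>a\<close> = 1.\<close>
    have "removeAll 1 w = []"
    proof (cases "removeAll 1 w")
      case (Cons b u)
      then have "b \<noteq> 1"
        using list.set_intros(1)[of b u] unfolding Cons[symmetric] by simp
      moreover have "w \<noteq> [] \<and> hd w = b"
        using w Cons by (metis append_Cons list.distinct(1) list.sel(1))
      ultimately show ?thesis
        using Cons.prems True by (cases w) simp_all
    qed
    then show ?thesis
      using w True by simp
  qed (use w in auto)
qed simp

section \<open>Maps applied at positions, sweeps and reachability\<close>

lemma apply2_at_Cons: "1 \<le> i \<Longrightarrow> apply2_at h (Suc i) (y # w) = y # apply2_at h i w"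
  by (cases i) (auto simp: apply2_at_def)

lemma apply2_at_append:
  "1 \<le> i \<Longrightarrow> i < length v \<Longrightarrow> apply2_at h i (v @ u) = apply2_at h i v @ u"
  by (auto simp: apply2_at_def nth_append split: prod.split)

lemma fold_apply2_at_Cons:
  "\<forall>i\<in>set is. 1 \<le> i \<Longrightarrow>
    fold (apply2_at h) (map Suc is) (y # w) = y # fold (apply2_at h) is w"
  by (induction "is" arbitrary: w) (auto simp: apply2_at_Cons)

lemma fold_apply2_at_append:
  "set is \<subseteq> {1..<length v} \<Longrightarrow>
    fold (apply2_at h) is (v @ u) = fold (apply2_at h) is v @ u"
  by (induction "is" arbitrary: v) (auto simp: apply2_at_append length_apply2_at)

lemma T_phi_Nil [simp]: "T_phi \<phi> [] = []"
  and T_phi_single [simp]: "T_phi \<phi> [s] = [s]"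
  by (auto simp: T_phi_def)

text \<open>Position 1 is treated first and its first entry is never touched again; the second
  entry, the carry, enters the sweep of the rest.\<close>

lemma T_phi_Cons2 [simp]:
  "T_phi \<phi> (s # x # w) = fst (\<phi> (s, x)) # T_phi \<phi> (snd (\<phi> (s, x)) # w)"
proof -
  have *: "[1..<Suc (Suc n)] = 1 # map Suc [1..<Suc n]" for n
    by (simp only: map_Suc_upt) (simp add: upt_rec)
  have "apply2_at \<phi> 1 (s # x # w) = fst (\<phi> (s, x)) # snd (\<phi> (s, x)) # w"
    by (simp add: apply2_at_def split: prod.split)
  then show ?thesis
    by (simp add: T_phi_def * fold_apply2_at_Cons del: upt_Suc map_Suc_upt One_nat_def)
qed

lemma T_phi_fixed:
  "successively (\<lambda>a b. \<phi> (a, b) = (a, b)) w \<Longrightarrow> T_phi \<phi> w = w"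
  by (induction w rule: induct_list012) auto

text \<open>The reachability required in \<open>quadratic_normalisation\<close>, for arbitrary
  target words so that it can be composed.\<close>

definition reaches :: "('a \<times> 'a \<Rightarrow> 'a \<times> 'a) \<Rightarrow> 'a list \<Rightarrow> 'a list \<Rightarrow> bool" where
  "reaches \<phi> v w \<longleftrightarrow> (\<exists>is. set is \<subseteq> {1..<length v} \<and> w = fold (apply2_at \<phi>) is v)"

lemma reaches_refl: "reaches \<phi> w w"
  unfolding reaches_def by (rule exI[of _ "[]"]) simp

lemma reaches_length: "reaches \<phi> v w \<Longrightarrow> length w = length v"
  by (auto simp: reaches_def length_fold_apply2_at)

lemma reaches_trans:
  assumes "reaches \<phi> u v" "reaches \<phi> v w"
  shows "reaches \<phi> u w"
proof -
  obtain xs ys where "set xs \<subseteq> {1..<length u}" "v = fold (apply2_at \<phi>) xs u"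
    "set ys \<subseteq> {1..<length u}" "w = fold (apply2_at \<phi>) ys v"
    using assms reaches_length[OF assms(1)] by (auto simp: reaches_def)
  then show ?thesis
    unfolding reaches_def by (intro exI[of _ "xs @ ys"]) auto
qed

lemma reaches_Cons:
  assumes "reaches \<phi> v w"
  shows "reaches \<phi> (x # v) (x # w)"
proof -
  obtain xs where "set xs \<subseteq> {1..<length v}" "w = fold (apply2_at \<phi>) xs v"
    using assms by (auto simp: reaches_def)
  then show ?thesis
    unfolding reaches_def
    by (intro exI[of _ "map Suc xs"]) (subst fold_apply2_at_Cons, auto)
qed

lemma reaches_append:
  assumes "reaches \<phi> v w"
  shows "reaches \<phi> (v @ u) (w @ u)"
proof -
  obtain xs where "set xs \<subseteq> {1..<length v}" "w = fold (apply2_at \<phi>) xs v"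
    using assms by (auto simp: reaches_def)
  then show ?thesis
    unfolding reaches_def by (intro exI[of _ xs]) (auto simp: fold_apply2_at_append)
qed

lemma reaches_T_phi: "reaches \<phi> w (T_phi \<phi> w)"
  unfolding reaches_def T_phi_def by (intro exI[of _ "[1..<length w]"]) auto


section \<open>Word length\<close>

locale generated_monoid =
  fixes S :: "'a::monoid_mult set"
  assumes generating: "prod_list ` lists S = UNIV" and one_mem: "1 \<in> S"
begin

abbreviation len :: "'a \<Rightarrow> nat" where "len \<equiv> word_length S"

lemma ex_word: "\<exists>w. w \<in> lists S \<and> prod_list w = f"
proof -
  have "f \<in> prod_list ` lists S" by (simp add: generating)
  then show ?thesis by blast
qed

lemma ex_shortest_word: "\<exists>w\<in>lists S. prod_list w = f \<and> length w = len f"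
  unfolding word_length_def
  by (rule LeastI_ex) (use ex_word[of f] in blast)

lemma len_prod_list_le: "w \<in> lists S \<Longrightarrow> len (prod_list w) \<le> length w"
  unfolding word_length_def by (rule Least_le) blast

lemma len_mult_le: "len (f * g) \<le> len f + len g"
proof -
  obtain v w where "v \<in> lists S" "prod_list v = f" "length v = len f"
    and "w \<in> lists S" "prod_list w = g" "length w = len g"
    using ex_shortest_word by meson
  then show ?thesis using len_prod_list_le[of "v @ w"] by simp
qed

lemma len_eq_0_iff [simp]: "len f = 0 \<longleftrightarrow> f = 1"
  using ex_shortest_word[of f] len_prod_list_le[of "[]"] by auto

lemma len_one [simp]: "len 1 = 0"
  by simp

lemma len_letter [simp]: "s \<in> S \<Longrightarrow> s \<noteq> 1 \<Longrightarrow> len s = 1"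
  using len_prod_list_le[of "[s]"] len_eq_0_iff[of s] by (simp del: len_eq_0_iff)

lemma letter_if_len_le_1: "len f \<le> 1 \<Longrightarrow> f \<in> S"
  using ex_shortest_word[of f] one_mem by (auto simp: length_Suc_conv le_Suc_eq)

section \<open>Sweeps over S and a criterion for \<open>N_phi\<close>\<close>

lemma T_phi_lists:
  assumes "\<And>s t. s \<in> S \<Longrightarrow> t \<in> S \<Longrightarrow> \<phi> (s, t) \<in> S \<times> S"
  shows "w \<in> lists S \<Longrightarrow> T_phi \<phi> w \<in> lists S"
proof (cases w)
  case (Cons s v)
  have "s \<in> S \<Longrightarrow> v \<in> lists S \<Longrightarrow> T_phi \<phi> (s # v) \<in> lists S" for s v
    using assms by (induction v arbitrary: s) (auto simp: mem_Times_iff)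
  then show "w \<in> lists S \<Longrightarrow> T_phi \<phi> w \<in> lists S" using Cons by auto
qed simp

lemma prod_list_T_phi:
  assumes "\<And>s t. s \<in> S \<Longrightarrow> t \<in> S \<Longrightarrow> \<phi> (s, t) \<in> S \<times> S"
    and "\<And>s t. s \<in> S \<Longrightarrow> t \<in> S \<Longrightarrow> fst (\<phi> (s, t)) * snd (\<phi> (s, t)) = s * t"
  shows "w \<in> lists S \<Longrightarrow> prod_list (T_phi \<phi> w) = prod_list w"
proof (cases w)
  case (Cons s v)
  have "s \<in> S \<Longrightarrow> v \<in> lists S \<Longrightarrow> prod_list (T_phi \<phi> (s # v)) = s * prod_list v" for s v
  proof (induction v arbitrary: s)
    case (Cons x v)
    then have "prod_list (T_phi \<phi> (s # x # v)) = fst (\<phi> (s, x)) * (snd (\<phi> (s, x)) * prod_list v)"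
      using assms(1)[of s x] by (auto simp: mem_Times_iff)
    then show ?case
      using assms(2)[of s x] Cons.prems by (metis Cons_in_lists_iff mult.assoc prod_list.Cons)
  qed simp
  then show "w \<in> lists S \<Longrightarrow> prod_list (T_phi \<phi> w) = prod_list w" using Cons by auto
qed simp

text \<open>A carry 1 swaps past every letter and ends up last. Hence a sweep whose result has no 1
  never carries a 1.\<close>

lemma T_phi_one_Cons:
  assumes "\<And>x. x \<in> S \<Longrightarrow> \<phi> (1, x) = (x, 1)"
  shows "w \<in> lists S \<Longrightarrow> T_phi \<phi> (1 # w) = w @ [1]"
  by (induction w) (auto simp: assms)

text \<open>Serves both directions, which differ only in how the property of \<open>T_phi\<close> is
  proved. If the sweep creates a 1, \<open>N_phi\<close> recurses on a word with the same product;
  otherwise the swept word is already the normal form.\<close>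

lemma N_phi_eqI:
  assumes "\<And>s t. s \<in> S \<Longrightarrow> t \<in> S \<Longrightarrow> \<phi> (s, t) \<in> S \<times> S"
    and "\<And>s t. s \<in> S \<Longrightarrow> t \<in> S \<Longrightarrow> fst (\<phi> (s, t)) * snd (\<phi> (s, t)) = s * t"
    and "\<And>f. nf f \<in> lists S" "\<And>f. prod_list (nf f) = f" "nf 1 = []"
    and "\<And>s f. s \<in> S - {1} \<Longrightarrow> 1 \<notin> set (T_phi \<phi> (s # nf f)) \<Longrightarrow>
      T_phi \<phi> (s # nf f) = nf (s * f)"
    and "w \<in> lists S"
  shows "N_phi \<phi> w = nf (prod_list w)"
  using assms
proof (induction \<phi> w rule: N_phi.induct)
  case (2 \<phi> s w)
  note prems = "2.prems"
  show ?case
  proof (cases "1 \<in> set (s # w)")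
    case True
    have "removeAll 1 (s # w) \<in> lists S"
      using prems(7) by (auto simp del: removeAll.simps)
    with True show ?thesis
      using "2.IH"(1)[OF True prems(1-6)] prod_list_removeAll_one[of "s # w"]
      by (simp del: removeAll.simps prod_list_removeAll_one)
  next
    case False
    then have w: "N_phi \<phi> w = nf (prod_list w)"
      using "2.IH"(2)[OF False prems(1-6)] prems(7) by simp
    define v where "v = T_phi \<phi> (s # N_phi \<phi> w)"
    have sw: "s # N_phi \<phi> w \<in> lists S"
      using w prems(3,7) by simp
    have v: "v \<in> lists S" "prod_list v = prod_list (s # w)"
      using T_phi_lists[of \<phi>, OF prems(1) sw] prod_list_T_phi[of \<phi>, OF prems(1,2) sw]
      by (auto simp: v_def w prems(4))
    show ?thesis
    proof (cases "1 \<in> set v")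
      case True
      then have "N_phi \<phi> v = nf (prod_list v)"
        using "2.IH"(3)[OF False v_def True prems(1-6) v(1)] by simp
      then show ?thesis
        using True False v by (simp add: v_def[symmetric] Let_def)
    next
      case no_one: False
      have "v = nf (s * prod_list w)"
        using prems(6)[of s "prod_list w"] no_one False prems(7) by (auto simp: v_def w)
      then show ?thesis
        using no_one False by (simp add: v_def[symmetric] Let_def)
    qed
  qed
qed simp

end


section \<open>From factorability structures to normalisations\<close>

locale factorable_monoid = generated_monoid S for S :: "'a::monoid_mult set" +
  fixes \<eta> :: "'a \<Rightarrow> 'a \<times> 'a"
  assumes factorability: "factorability_structure S \<eta>"
begin

abbreviation stable :: "'a \<Rightarrow> 'a \<Rightarrow> bool" where
  "stable a b \<equiv> \<eta> (a * b) = (a, b)"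

section \<open>Lengths and letters under \<open>\<eta>\<close>\<close>

lemma eta_one [simp]: "\<eta> 1 = (1, 1)"
  using factorability by (simp add: factorability_structure_def factorisation_map_def)

lemma fst_eta: "f \<noteq> 1 \<Longrightarrow> fst (\<eta> f) \<in> S - {1}"
  using factorability by (auto simp: factorability_structure_def factorisation_map_def)

lemma fst_eta_in [simp]: "fst (\<eta> f) \<in> S"
  using fst_eta[of f] one_mem by (cases "f = 1") auto

lemma fst_eta_eq_1_iff [simp]: "fst (\<eta> f) = 1 \<longleftrightarrow> f = 1"
  using fst_eta[of f] by auto

lemma eta_prod [simp]: "fst (\<eta> f) * snd (\<eta> f) = f"
  using factorability
  by (cases "f = 1") (auto simp: factorability_structure_def factorisation_map_def)

lemma len_eta: "len (fst (\<eta> f)) + len (snd (\<eta> f)) = len f"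
  using factorability
  by (cases "f = 1") (auto simp: factorability_structure_def factorisation_map_def)

lemma len_snd_eta: "f \<noteq> 1 \<Longrightarrow> len f = Suc (len (snd (\<eta> f)))"
  using len_eta[of f] len_letter[of "fst (\<eta> f)"] by simp

lemma eta_letter [simp]: "s \<in> S \<Longrightarrow> \<eta> s = (s, 1)"
proof (cases "s = 1")
  case False
  assume "s \<in> S"
  then have "snd (\<eta> s) = 1"
    using len_snd_eta[OF False] False by simp
  then show ?thesis using eta_prod[of s] by (cases "\<eta> s") simp
qed simp

text \<open>A product of two letters has length at most 2, so splitting off a letter leaves length
  at most 1. This lets \<open>phi_of_eta\<close> map pairs of letters to pairs of letters.\<close>

lemma snd_eta_mult_in: "s \<in> S \<Longrightarrow> t \<in> S \<Longrightarrow> snd (\<eta> (s * t)) \<in> S"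
proof (cases "s * t = 1")
  case False
  assume "s \<in> S" "t \<in> S"
  then have "len (s * t) \<le> 2"
    using len_prod_list_le[of "[s, t]"] by simp
  then show ?thesis
    using len_snd_eta[OF False] by (intro letter_if_len_le_1) simp
qed (simp add: one_mem)

lemma factorability_cases:
  fixes a b c :: 'a
  defines "F1 \<equiv> apply2_at (\<eta> \<circ> mult_pair) 1" and "F2 \<equiv> apply2_at (\<eta> \<circ> mult_pair) 2"
  obtains "F1 (F2 (F1 (F2 [a, b, c]))) = F2 (F1 (F2 [a, b, c]))"
      "F2 (F1 (F2 [a, b, c])) = F2 (F1 (F2 (F1 [a, b, c])))"
    | "total_length S (F2 (F1 (F2 [a, b, c]))) < len a + len b + len c"
      "total_length S (F2 (F1 (F2 (F1 [a, b, c])))) < len a + len b + len c"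
proof -
  have "total_length S [a, b, c] = len a + len b + len c"
    by (simp add: total_length_def)
  then show thesis
    using factorability that
    unfolding factorability_structure_def Let_def F1_def F2_def by metis
qed

lemmas F_simps = apply2_at_def mult_pair_def total_length_def case_prod_unfold

text \<open>On (1, f, 1) the composite \<open>F2 F1 F2\<close> yields the first two letters of f and
  the rest, of total length \<open>len f\<close>. So the strict alternative is impossible, and
  invariance under a further \<open>F1\<close> is the claim.\<close>

lemma stable_fst_eta: "stable (fst (\<eta> f)) (fst (\<eta> (snd (\<eta> f))))"
proof -
  have f: "len (fst (\<eta> f)) + (len (fst (\<eta> (snd (\<eta> f)))) + len (snd (\<eta> (snd (\<eta> f))))) = len f"
    by (simp add: len_eta)
  show ?thesis
    by (rule factorability_cases[of 1 f 1]) (use f in \<open>auto simp: F_simps prod_eq_iff\<close>)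
qed

text \<open>The axiom for the triple (s, f, 1): here the application of F at the first position
  computes the normal form of the product s f, and at the second position that of f.\<close>

lemma eta_mult_cases:
  fixes s f :: 'a
  defines "p \<equiv> \<eta> (s * fst (\<eta> f))" and "g \<equiv> snd (\<eta> f)"
  obtains "\<eta> (s * f) = (fst p, snd p * g)"
    | "len (fst p) + len (snd p * g) < len s + len f"
proof (rule factorability_cases[of s f 1])
  assume "apply2_at (\<eta> \<circ> mult_pair) 2 (apply2_at (\<eta> \<circ> mult_pair) 1
      (apply2_at (\<eta> \<circ> mult_pair) 2 [s, f, 1])) =
    apply2_at (\<eta> \<circ> mult_pair) 2 (apply2_at (\<eta> \<circ> mult_pair) 1
      (apply2_at (\<eta> \<circ> mult_pair) 2 (apply2_at (\<eta> \<circ> mult_pair) 1 [s, f, 1])))"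
  \<comment> \<open>On the right, after \<open>F1\<close> and \<open>F2\<close> the word begins with
    the first two letters of s f, which the next \<open>F1\<close> fixes by
    \<open>stable_fst_eta\<close>. Then the entries can be compared.\<close>
  then have "fst p = fst (\<eta> (s * f))" "\<eta> (snd p * g) = \<eta> (snd (\<eta> (s * f)))"
    using stable_fst_eta[of "s * f"] by (auto simp: F_simps p_def g_def prod_eq_iff)
  moreover from this(2) have "snd p * g = snd (\<eta> (s * f))"
    by (metis eta_prod)
  ultimately show thesis using that(1) by (simp add: prod_eq_iff)
next
  assume "total_length S (apply2_at (\<eta> \<circ> mult_pair) 2 (apply2_at (\<eta> \<circ> mult_pair) 1
      (apply2_at (\<eta> \<circ> mult_pair) 2 [s, f, 1]))) < len s + len f + len 1"
  then have "len (fst p) + (len (fst (\<eta> (snd p * g))) + len (snd (\<eta> (snd p * g)))) < len s + len f"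
    by (simp add: F_simps p_def g_def)
  then show thesis using that(2) by (simp add: len_eta)
qed

section \<open>Normal forms and sweeps\<close>

abbreviation nf :: "'a \<Rightarrow> 'a list" where "nf \<equiv> eta_nf S \<eta>"

lemma nf_one [simp]: "nf 1 = []"
  by (simp add: eta_nf_def)

text \<open>Splitting at position 1 leaves positions 2, 3, ..., which act on the remainder as 1, 2,
  ...; if the remainder is 1, then \<open>len f\<close> = 1 and no position occurs.\<close>

lemma nf_rec:
  assumes "f \<noteq> 1"
  shows "nf f = fst (\<eta> f) # nf (snd (\<eta> f))"
proof (cases "snd (\<eta> f) = 1")
  case True
  then have "len f = 1" "fst (\<eta> f) = f"
    using len_snd_eta[OF assms] eta_prod[of f] by auto
  then show ?thesis using assms True by (simp add: eta_nf_def)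
next
  case False
  have shift: "fold (apply1_at \<eta>) (map Suc is) (x # w) = x # fold (apply1_at \<eta>) is w"
    if "\<forall>i\<in>set is. 1 \<le> i" for "is" x w
    using that
  proof (induction "is" arbitrary: w)
    case (Cons i "is")
    then show ?case by (cases i) (auto simp: apply1_at_def)
  qed simp
  obtain n where n: "len (snd (\<eta> f)) = Suc n"
    using False by (cases "len (snd (\<eta> f))") auto
  then have "len f = Suc (Suc n)"
    using len_snd_eta[OF assms] by simp
  moreover have "[1..<Suc (Suc n)] = 1 # map Suc [1..<Suc n]"
    by (simp only: map_Suc_upt) (simp add: upt_rec)
  moreover have "apply1_at \<eta> 1 [f] = [fst (\<eta> f), snd (\<eta> f)]"
    by (simp add: apply1_at_def case_prod_unfold)
  ultimately show ?thesis
    using assms False n by (simp add: eta_nf_def shift del: upt_Suc map_Suc_upt One_nat_def)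
qed

lemma nf_induct [case_names one mult]:
  assumes "P 1" and "\<And>f. f \<noteq> 1 \<Longrightarrow> P (snd (\<eta> f)) \<Longrightarrow> P f"
  shows "P f"
  by (induction f rule: measure_induct_rule[of len]) (metis assms len_snd_eta lessI)

lemma nf_letters: "nf f \<in> lists (S - {1})"
  by (induction f rule: nf_induct) (auto simp: nf_rec)

lemma nf_in_lists: "nf f \<in> lists S" and one_notin_nf: "1 \<notin> set (nf f)"
  using nf_letters[of f] by auto

lemma prod_list_nf [simp]: "prod_list (nf f) = f"
  by (induction f rule: nf_induct) (auto simp: nf_rec)

lemma length_nf [simp]: "length (nf f) = len f"
  by (induction f rule: nf_induct) (auto simp: nf_rec len_snd_eta simp del: len_eq_0_iff)

lemma nf_letter: "s \<in> S \<Longrightarrow> s \<noteq> 1 \<Longrightarrow> nf s = [s]"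
  by (simp add: nf_rec)

lemma successively_stable_nf: "successively stable (nf f)"
proof (induction f rule: nf_induct)
  case (mult f)
  then show ?case
    using stable_fst_eta[of f] by (cases "snd (\<eta> f) = 1") (auto simp: nf_rec)
qed simp

text \<open>Only the values on S \<times> S are fixed, so that the results apply to
  \<open>phi_of_eta\<close> as well as to \<open>N_bar\<close> of the resulting
  normalisation.\<close>

context
  fixes \<psi> :: "'a \<times> 'a \<Rightarrow> 'a \<times> 'a"
  assumes psi: "\<And>s t. s \<in> S \<Longrightarrow> t \<in> S \<Longrightarrow> \<psi> (s, t) = \<eta> (s * t)"
begin

lemma psi_in: "s \<in> S \<Longrightarrow> t \<in> S \<Longrightarrow> \<psi> (s, t) \<in> S \<times> S"
  and psi_prod: "s \<in> S \<Longrightarrow> t \<in> S \<Longrightarrow> fst (\<psi> (s, t)) * snd (\<psi> (s, t)) = s * t"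
  and psi_one: "s \<in> S \<Longrightarrow> \<psi> (1, s) = (s, 1)"
  by (auto simp: psi snd_eta_mult_in mem_Times_iff one_mem)

text \<open>Induction on f. The sweep keeps the number of letters, so without a 1 in it no length is
  lost, and \<open>eta_mult_cases\<close> leaves only the equation for
  \<open>\<eta>\<close>.\<close>

lemma T_phi_nf:
  assumes "s \<in> S - {1}" "1 \<notin> set (T_phi \<psi> (s # nf f))"
  shows "T_phi \<psi> (s # nf f) = nf (s * f)"
  using assms
proof (induction f arbitrary: s rule: nf_induct)
  case one
  then show ?case by (simp add: nf_letter)
next
  case (mult f)
  define x g where "x = fst (\<eta> f)" and "g = snd (\<eta> f)"
  define y t where "y = fst (\<eta> (s * x))" and "t = snd (\<eta> (s * x))"
  have x: "x \<in> S - {1}" and g: "len f = Suc (len g)"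
    using mult.hyps fst_eta len_snd_eta by (auto simp: x_def g_def)
  have T: "T_phi \<psi> (s # nf f) = y # T_phi \<psi> (t # nf g)"
    using mult.hyps mult.prems(1) x by (simp add: nf_rec psi x_def g_def y_def t_def)
  \<comment> \<open>A carry 1 would appear at the end of the sweep.\<close>
  have "t \<noteq> 1"
    using mult.prems(2) T T_phi_one_Cons[OF psi_one nf_in_lists, of g] by auto
  moreover have "t \<in> S"
    using mult.prems(1) x snd_eta_mult_in by (simp add: t_def)
  ultimately have IH: "T_phi \<psi> (t # nf g) = nf (t * g)"
    using mult.IH[of t] mult.prems(2) T by (simp add: g_def)
  then have "len (t * g) = Suc (len g)"
    by (metis length_Cons length_T_phi length_nf)
  moreover have "y \<noteq> 1" "y \<in> S"
    using mult.prems(2) T by (auto simp: y_def)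
  ultimately have "\<not> len y + len (t * g) < len s + len f"
    using g mult.prems(1) by simp
  then have eta: "\<eta> (s * f) = (y, t * g)"
    using eta_mult_cases[of s f] by (auto simp: x_def g_def y_def t_def)
  then have "s * f \<noteq> 1" using \<open>y \<noteq> 1\<close> by auto
  then show ?case using eta by (simp add: nf_rec T IH)
qed

lemma N_phi_eq_nf: "w \<in> lists S \<Longrightarrow> N_phi \<psi> w = nf (prod_list w)"
  by (rule N_phi_eqI[of \<psi> nf, OF psi_in psi_prod nf_in_lists prod_list_nf nf_one T_phi_nf]) auto

text \<open>One sweep takes a letter 1 from the front to the end.\<close>

lemma reaches_removeAll_one:
  "w \<in> lists S \<Longrightarrow> \<exists>k. reaches \<psi> w (removeAll 1 w @ replicate k 1)"
proof (induction w)
  case Nil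
  show ?case using reaches_refl by (intro exI[of _ 0]) simp
next
  case (Cons a w)
  then obtain k where "reaches \<psi> w (removeAll 1 w @ replicate k 1)" by auto
  then have 1: "reaches \<psi> (a # w) (a # removeAll 1 w @ replicate k 1)"
    by (rule reaches_Cons)
  show ?case
  proof (cases "a = 1")
    case True
    have "removeAll 1 w @ replicate k 1 \<in> lists S"
      using Cons.prems one_mem by auto
    then have "reaches \<psi> (1 # removeAll 1 w @ replicate k 1) (removeAll 1 w @ replicate k 1 @ [1])"
      using reaches_T_phi[of \<psi> "1 # removeAll 1 w @ replicate k 1"] T_phi_one_Cons[OF psi_one]
      by simp
    then have "reaches \<psi> (1 # removeAll 1 w @ replicate k 1) (removeAll 1 w @ replicate (Suc k) 1)"
      by (simp only: replicate_append_same replicate_Suc)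
    then show ?thesis
      using 1 True reaches_trans by (metis removeAll.simps(2))
  next
    case False
    then show ?thesis using 1 by auto
  qed
qed

text \<open>Follows the computation of \<open>N_phi\<close> by steps at positions, which gives the
  reachability clause of \<open>quadratic_normalisation\<close>. The measure counts the letters
  other than 1.\<close>

lemma reaches_nf: "w \<in> lists S \<Longrightarrow> \<exists>k. reaches \<psi> w (nf (prod_list w) @ replicate k 1)"
proof (induction w rule: measure_induct_rule[of "\<lambda>w. length (removeAll 1 w)"])
  case (less w)
  obtain k where k: "reaches \<psi> w (removeAll 1 w @ replicate k 1)"
    using reaches_removeAll_one less.prems by blast
  show ?case
  proof (cases "removeAll 1 w")
    case Nil
    then have "prod_list w = 1" using prod_list_removeAll_one[of w] by simp
    then show ?thesis using k Nil by auto
  next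
    case (Cons s v)
    have "set (s # v) \<subseteq> S - {1}"
      unfolding Cons[symmetric] using less.prems by auto
    then have sv: "s \<in> S - {1}" "v \<in> lists S" "1 \<notin> set v" by auto
    then have "length (removeAll 1 v) < length (removeAll 1 w)"
      using Cons by (simp add: removeAll_id)
    then obtain m where "reaches \<psi> v (nf (prod_list v) @ replicate m 1)"
      using less.IH sv by blast
    then have "reaches \<psi> (s # v) (s # nf (prod_list v) @ replicate m 1)"
      by (rule reaches_Cons)
    then have 1: "reaches \<psi> (removeAll 1 w @ replicate k 1)
        ((s # nf (prod_list v)) @ replicate (m + k) 1)"
      using reaches_append[of \<psi> "s # v" _ "replicate k 1"] Cons
      by (fastforce simp: replicate_add)
    define T where "T = T_phi \<psi> (s # nf (prod_list v))"
    have "reaches \<psi> ((s # nf (prod_list v)) @ replicate (m + k) 1) (T @ replicate (m + k) 1)"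
      unfolding T_def by (intro reaches_append reaches_T_phi)
    then have wT: "reaches \<psi> w (T @ replicate (m + k) 1)"
      using k 1 reaches_trans by blast
    have nf: "s # nf (prod_list v) \<in> lists S"
      using sv nf_in_lists by simp
    have w: "prod_list w = s * prod_list v"
      using prod_list_removeAll_one[of w] Cons by simp
    have T: "T \<in> lists S" "prod_list T = prod_list w"
      using T_phi_lists[of \<psi>, OF psi_in nf] prod_list_T_phi[of \<psi>, OF psi_in psi_prod nf]
      by (auto simp: T_def w)
    show ?thesis
    proof (cases "1 \<in> set T")
      case True
      \<comment> \<open>The sweep has at most as many letters as w has letters other than 1, and one
        of them is now a 1.\<close>
      have "len (prod_list v) \<le> length v" using len_prod_list_le sv by blast
      then have "length T \<le> length (removeAll 1 w)"
        by (simp add: T_def Cons)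
      then have "length (removeAll 1 (T @ replicate (m + k) 1)) < length (removeAll 1 w)"
        using length_removeAll_less[OF True] by simp
      moreover have "T @ replicate (m + k) 1 \<in> lists S" using T one_mem by auto
      ultimately obtain l where
        "reaches \<psi> (T @ replicate (m + k) 1) (nf (prod_list w) @ replicate l 1)"
        using less.IH[of "T @ replicate (m + k) 1"] T by auto
      then show ?thesis using wT reaches_trans by blast
    next
      case False
      then have "T = nf (prod_list w)"
        using T_phi_nf sv by (simp add: T_def w)
      then show ?thesis using wT by auto
    qed
  qed
qed

end

section \<open>The corresponding normalisation\<close>

abbreviation N :: "'a list \<Rightarrow> 'a list" where "N \<equiv> N_of_eta S \<eta>"

lemma phi_of_eta_eq: "s \<in> S \<Longrightarrow> t \<in> S \<Longrightarrow> phi_of_eta S \<eta> (s, t) = \<eta> (s * t)"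
  by (simp add: phi_of_eta_def mult_pair_def)

lemma N_eq:
  "w \<in> lists S \<Longrightarrow> N w = nf (prod_list w) @ replicate (length w - len (prod_list w)) 1"
  by (simp add: N_of_eta_def N_phi'_def N_phi_eq_nf[OF phi_of_eta_eq])

lemma N_in_lists: "w \<in> lists S \<Longrightarrow> N w \<in> lists S"
  using nf_in_lists one_mem by (auto simp: N_eq)

lemma length_N: "w \<in> lists S \<Longrightarrow> length (N w) = length w"
  using len_prod_list_le by (simp add: N_eq)

lemma prod_list_N: "w \<in> lists S \<Longrightarrow> prod_list (N w) = prod_list w"
  by (simp add: N_eq)

text \<open>A remainder 1 of \<open>\<eta>\<close> coincides with the padding letter, so that
  \<open>N_bar N\<close> is \<open>\<eta>\<close> after multiplication.\<close>

lemma N_pair: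
  assumes "s \<in> S" "t \<in> S"
  shows "N [s, t] = [fst (\<eta> (s * t)), snd (\<eta> (s * t))]"
proof (cases "s * t = 1")
  case True
  then show ?thesis using assms by (simp add: N_eq eval_nat_numeral)
next
  case False
  then show ?thesis
    using assms snd_eta_mult_in[OF assms] len_snd_eta[OF False]
    by (cases "snd (\<eta> (s * t)) = 1") (auto simp: N_eq nf_rec)
qed

lemma N_bar_eq: "s \<in> S \<Longrightarrow> t \<in> S \<Longrightarrow> N_bar N (s, t) = \<eta> (s * t)"
  by (simp add: N_bar_def N_pair)

text \<open>A stable word has its letters 1 at the end. Before them, a letter \<open>a\<close>
  sweeps through \<open>nf f\<close> without any change, so \<open>T_phi_nf\<close> recognises the
  unchanged word as a normal form.\<close>

lemma nf_stable_word:
  assumes "w \<in> lists S" "successively stable w"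
  shows "w = nf (prod_list w) @ replicate (length w - len (prod_list w)) 1"
  using assms
proof (induction w rule: list.induct)
  case (Cons a w)
  let ?\<psi> = "phi_of_eta S \<eta>"
  define f m where "f = prod_list w" and "m = length w - len f"
  have w: "w = nf f @ replicate m 1"
    unfolding f_def m_def using Cons.prems by (intro Cons.IH) (auto simp: successively_Cons)
  have len: "length w = len f + m"
    using arg_cong[OF w, of length] by simp
  show ?case
  proof (cases "a = 1")
    case True
    \<comment> \<open>Otherwise 1 would stand before the first letter b \<noteq> 1 of
      \<open>nf f\<close>, but \<open>\<eta>\<close> sends 1 b to (b, 1).\<close>
    have "f = 1"
    proof (rule ccontr)
      assume "f \<noteq> 1"
      then obtain b v where "nf f = b # v" "b \<in> S - {1}"
        using nf_letters[of f] by (auto simp: nf_rec)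
      then show False using Cons.prems w True by auto
    qed
    then have "w = replicate (length w) 1" using w by simp
    then show ?thesis using True \<open>f = 1\<close> by (simp add: f_def)
  next
    case False
    then have a: "a \<in> S - {1}" using Cons.prems(1) by simp
    have "successively stable ((a # nf f) @ replicate m 1)"
      using Cons.prems w by simp
    then have "successively stable (a # nf f)"
      unfolding successively_append_iff by blast
    then have "successively (\<lambda>a b. ?\<psi> (a, b) = (a, b)) (a # nf f)"
      using a nf_in_lists[of f] by (elim successively_mono) (auto simp: phi_of_eta_eq)
    then have T: "T_phi ?\<psi> (a # nf f) = a # nf f" by (rule T_phi_fixed)
    then have nf: "nf (a * f) = a # nf f"
      using T_phi_nf[of ?\<psi>, OF phi_of_eta_eq a, of f] one_notin_nf[of f] a by auto
    then have "len (a * f) = Suc (len f)"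
      by (metis length_Cons length_nf)
    moreover have "prod_list (a # w) = a * f" "length (a # w) = Suc (len f + m)"
      using len by (simp_all add: f_def)
    moreover have "a # w = (a # nf f) @ replicate m 1"
      using w by simp
    ultimately show ?thesis
      using nf by (simp only: diff_Suc_Suc diff_add_inverse)
  qed
qed simp

lemma N_fixed_iff:
  assumes "w \<in> lists S"
  shows "N w = w \<longleftrightarrow> successively stable w"
proof
  assume "N w = w"
  moreover have "successively stable (nf f @ replicate m 1)" for f m
  proof -
    have "successively stable (replicate m 1)" by (induction m rule: induct_nat_012) auto
    moreover have "nf f \<noteq> [] \<longrightarrow> last (nf f) \<in> S"
      using nf_in_lists[of f] by auto
    ultimately show ?thesis
      by (cases m) (auto simp: successively_append_iff successively_stable_nf)
  qed
  ultimately show "successively stable w"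
    using N_eq[OF assms] by metis
qed (use assms nf_stable_word N_eq in simp)

text \<open>Replacing v by \<open>N v\<close> changes neither the product nor the length of the
  whole word.\<close>

lemma normalisation_N: "normalisation S N"
  unfolding normalisation_def
proof (intro conjI ballI funcsetI)
  fix a assume "a \<in> S"
  then show "N [a] = [a]" by (cases "a = 1") (auto simp: N_eq nf_letter)
next
  fix u v w assume "u \<in> lists S" "v \<in> lists S" "w \<in> lists S"
  then show "N (u @ v @ w) = N (u @ N v @ w)"
    using N_in_lists[of v]
    by (subst (1 2) N_eq) (auto simp: prod_list_N length_N simp del: in_lists_conv_set)
qed (auto simp: N_in_lists length_N)

lemma quadratic_N: "quadratic_normalisation S N"
  unfolding quadratic_normalisation_def all_sublist_pairs_iff_successively
proof (intro conjI ballI)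
  fix w assume w: "w \<in> lists S"
  have "successively (\<lambda>s t. N [s, t] = [s, t]) w \<longleftrightarrow> successively stable w"
    using w by (intro successively_cong) (auto simp: N_pair prod_eq_iff)
  then show "N w = w \<longleftrightarrow> successively (\<lambda>s t. N [s, t] = [s, t]) w"
    using N_fixed_iff[OF w] by simp
  obtain k where k: "reaches (N_bar N) w (nf (prod_list w) @ replicate k 1)"
    using reaches_nf[OF N_bar_eq w] by blast
  then have "k = length w - len (prod_list w)"
    using reaches_length by fastforce
  then have "reaches (N_bar N) w (N w)" using k N_eq[OF w] by simp
  then show "\<exists>is. set is \<subseteq> {1..<length w} \<and> N w = fold (apply2_at (N_bar N)) is w"
    unfolding reaches_def .
qed (rule normalisation_N)

lemma normalisation_mod_1_N: "normalisation_mod_1 S N"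
  unfolding normalisation_mod_1_def
proof (intro conjI normalisation_N)
  show "neutral_letter S N 1"
    unfolding neutral_letter_def
  proof (intro conjI ballI one_mem)
    fix w assume w: "w \<in> lists S"
    then have "N (w @ [1]) = N w @ [1] \<and> N (1 # w) = N w @ [1]"
      using len_prod_list_le[OF w] one_mem
      by (simp add: N_eq Suc_diff_le replicate_append_same)
    then show "N (w @ [1]) = N w @ [1]" "N (1 # w) = N w @ [1]" by auto
  qed
next
  let ?R = "{(w, N w) |w. w \<in> lists S} \<union> {([1], [])}"
  \<comment> \<open>The relation 1_S = 1 removes the padding; together with w = N w it makes every
    word congruent to the normal form of its product.\<close>
  have ones: "word_congruence S ?R (v @ replicate k 1) v" if "v \<in> lists S" for v k
  proof (induction k)
    case 0
    show ?case using that by (simp add: word_congruence.refl)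
  next
    case (Suc k)
    have "v @ replicate k 1 \<in> lists S" using that one_mem by auto
    then have "word_congruence S ?R ((v @ replicate k 1) @ [1] @ []) ((v @ replicate k 1) @ [] @ [])"
      using one_mem by (intro word_congruence.rel) auto
    then have "word_congruence S ?R (v @ replicate (Suc k) 1) (v @ replicate k 1)"
      by (simp add: replicate_append_same)
    then show ?case using Suc word_congruence.trans by blast
  qed
  have nf: "word_congruence S ?R w (nf (prod_list w))" if w: "w \<in> lists S" for w
  proof -
    have "word_congruence S ?R ([] @ w @ []) ([] @ N w @ [])"
      using w N_in_lists[OF w] by (intro word_congruence.rel) auto
    then show ?thesis
      using ones[OF nf_in_lists] N_eq[OF w] by (auto intro: word_congruence.trans)
  qed
  have "prod_list u = prod_list v" if "word_congruence S ?R u v" for u v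
    using that
  proof induction
    case (rel x y u v)
    then have "prod_list x = prod_list y"
      using prod_list_N[of x] by auto
    then show ?case by simp
  qed simp_all
  moreover have "word_congruence S ?R u v"
    if "u \<in> lists S" "v \<in> lists S" "prod_list u = prod_list v" for u v
    using word_congruence.trans[OF nf[OF that(1)]] word_congruence.sym[OF nf[OF that(2)]] that(3)
    by simp
  ultimately show "presented_by S ?R"
    unfolding presented_by_def using generating by (intro conjI ballI iffI)
qed

text \<open>The premises describe the sweep of s0 through r1|r2, a normal form. Its result
  r1'|r2'|s2 has no 1, so it is a normal form too and its neighbours are stable.\<close>

lemma weak_domino_N: "weak_domino_rule S (N_bar N)"
  unfolding weak_domino_rule_def
proof (intro ballI impI, elim conjE)
  fix r1 r2 r1' r2' s0 s1 s2
  assume S: "r1 \<in> S" "r2 \<in> S" "r1' \<in> S" "r2' \<in> S" "s0 \<in> S" "s1 \<in> S" "s2 \<in> S"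
    and "N_bar N (s0, r1) = (r1', s1)" "N_bar N (s1, r2) = (r2', s2)"
    and "N_bar N (r1, r2) = (r1, r2)"
    and ne: "r1' \<noteq> 1" "r2' \<noteq> 1" "s2 \<noteq> 1"
  then have eta: "\<eta> (s0 * r1) = (r1', s1)" "\<eta> (s1 * r2) = (r2', s2)" "stable r1 r2"
    by (auto simp: N_bar_eq)
  \<comment> \<open>A product with a factor 1 is a letter and would leave the remainder 1, whereas
    the remainders \<open>s2\<close> and then \<open>s1\<close> are not 1.\<close>
  have s1: "s1 \<noteq> 1" using eta(2) S ne by auto
  have r1: "r1 \<noteq> 1" and s0: "s0 \<noteq> 1" using eta(1) S s1 by auto
  have r2: "r2 \<noteq> 1" using eta(2) S ne by auto
  have "successively stable [r1, r2]" using eta(3) by simp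
  then have "[r1, r2] = nf (r1 * r2) @ replicate (2 - len (r1 * r2)) 1"
    using nf_stable_word[of "[r1, r2]"] S by (simp add: eval_nat_numeral)
  then have "removeAll 1 [r1, r2] = removeAll 1 (nf (r1 * r2))"
    by simp
  then have nf: "nf (r1 * r2) = [r1, r2]"
    using r1 r2 one_notin_nf[of "r1 * r2"] by (simp add: removeAll_id)
  have "T_phi (N_bar N) (s0 # nf (r1 * r2)) = [r1', r2', s2]"
    using S eta by (simp add: nf N_bar_eq)
  then have "nf (s0 * (r1 * r2)) = [r1', r2', s2]"
    using T_phi_nf[of "N_bar N", OF N_bar_eq, of s0 "r1 * r2"] S s0 ne by auto
  then have "stable r1' r2'"
    using successively_stable_nf[of "s0 * (r1 * r2)"] by simp
  then show "N_bar N (r1', r2') = (r1', r2')"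
    using S by (simp add: N_bar_eq)
qed

lemma phi_of_eta_funcset: "phi_of_eta S \<eta> \<in> S \<times> S \<rightarrow> S \<times> S"
  by (auto simp: phi_of_eta_eq mem_Times_iff snd_eta_mult_in)

lemma weak_domino_normalisation_N: "weak_domino_normalisation S N"
  unfolding weak_domino_normalisation_def
  using quadratic_N normalisation_mod_1_N weak_domino_N by blast

text \<open>The product of the tail is the remainder, because the tail of a normal form is the
  normal form of the remainder.\<close>

lemma eta_of_N_eq: "eta_of_N S N = \<eta>"
proof
  fix f
  show "eta_of_N S N f = \<eta> f"
  proof (cases "f = 1")
    case False
    define w where "w = (SOME w. w \<in> lists S \<and> prod_list w = f)"
    have "w \<in> lists S \<and> prod_list w = f"
      unfolding w_def by (rule someI_ex[OF ex_word])
    then have "N_phi (N_bar N) w = fst (\<eta> f) # nf (snd (\<eta> f))"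
      using N_phi_eq_nf[OF N_bar_eq] nf_rec[OF False] by simp
    then show ?thesis
      using False by (simp add: eta_of_N_def w_def[symmetric])
  qed (simp add: eta_of_N_def)
qed

lemma removeAll_one_N: "w \<in> lists S \<Longrightarrow> removeAll 1 (N w) = nf (prod_list w)"
  using one_notin_nf by (simp add: N_eq removeAll_id)

text \<open>If s or t is 1, both sides of a rule in \<open>normalisation_rules\<close> agree up to
  letters 1 and the pair is discarded. Otherwise deleting the padding implements the convention for
  a remainder 1.\<close>

lemma eta_rules_eq:
  "eta_rules S \<eta> = {(removeAll 1 u, removeAll 1 v) | u v.
     (u, v) \<in> normalisation_rules S N \<and> removeAll 1 u \<noteq> removeAll 1 v}"
proof -
  have rhs: "removeAll 1 (N [s, t]) = (if snd (\<eta> (s * t)) = 1 then (if s * t = 1 then [] else [s * t])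
      else [fst (\<eta> (s * t)), snd (\<eta> (s * t))])" if "s \<in> S" "t \<in> S" for s t
    using that by (auto simp: N_pair) (metis eta_prod mult_1_right)
  have letters: "removeAll 1 [s, t] = removeAll 1 (N [s, t])"
    if "s \<in> S" "t \<in> S" "s = 1 \<or> t = 1" for s t
    using that one_mem N_pair[of s t] by (cases "s = 1"; cases "t = 1") simp_all
  have normal: "N [s, t] = [s, t] \<longleftrightarrow> \<eta> (s * t) = (s, t)" if "s \<in> S" "t \<in> S" for s t
    using that by (auto simp: N_pair prod_eq_iff)
  show ?thesis
  proof (intro subset_antisym subsetI)
    fix p assume "p \<in> eta_rules S \<eta>"
    then obtain s t where st: "s \<in> S - {1}" "t \<in> S - {1}" "\<eta> (s * t) \<noteq> (s, t)"
      and p: "p = ([s, t], if snd (\<eta> (s * t)) = 1 then (if s * t = 1 then [] else [s * t])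
        else [fst (\<eta> (s * t)), snd (\<eta> (s * t))])"
      unfolding eta_rules_def by blast
    have "p = (removeAll 1 [s, t], removeAll 1 (N [s, t]))"
      using st p rhs[of s t] by simp
    moreover have "([s, t], N [s, t]) \<in> normalisation_rules S N"
      using st normal[of s t] by (auto simp: normalisation_rules_def)
    moreover have "removeAll 1 [s, t] \<noteq> removeAll 1 (N [s, t])"
      using st by (auto simp: rhs prod_eq_iff)
    ultimately show "p \<in> {(removeAll 1 u, removeAll 1 v) | u v.
        (u, v) \<in> normalisation_rules S N \<and> removeAll 1 u \<noteq> removeAll 1 v}"
      by blast
  next
    fix p assume "p \<in> {(removeAll 1 u, removeAll 1 v) | u v.
        (u, v) \<in> normalisation_rules S N \<and> removeAll 1 u \<noteq> removeAll 1 v}"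
    then obtain s t where st: "s \<in> S" "t \<in> S" "N [s, t] \<noteq> [s, t]"
      and p: "p = (removeAll 1 [s, t], removeAll 1 (N [s, t]))"
      and ne: "removeAll 1 [s, t] \<noteq> removeAll 1 (N [s, t])"
      unfolding normalisation_rules_def by blast
    have "s \<noteq> 1" "t \<noteq> 1"
      using letters[OF st(1,2)] ne by blast+
    then have "s \<in> S - {1}" "t \<in> S - {1}" "removeAll 1 [s, t] = [s, t]"
      using st by simp_all
    then show "p \<in> eta_rules S \<eta>"
      using normal[OF st(1,2)] st(3) p rhs[OF st(1,2)] unfolding eta_rules_def by blast
  qed
qed

end


section \<open>From normalisations to factorability structures\<close>

locale weak_domino_monoid = generated_monoid S for S :: "'a::monoid_mult set" +
  fixes N :: "'a list \<Rightarrow> 'a list"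
  assumes weak_domino_normalisation: "weak_domino_normalisation S N"
begin

section \<open>\<open>N\<close>-normal words and the neutral letter\<close>

lemma normalisation: "normalisation S N"
  and quadratic: "quadratic_normalisation S N"
  and neutral: "neutral_letter S N 1"
  and presented: "presented_by S ({(w, N w) | w. w \<in> lists S} \<union> {([1], [])})"
  and weak_domino: "weak_domino_rule S (N_bar N)"
  using weak_domino_normalisation
  by (auto simp: weak_domino_normalisation_def normalisation_mod_1_def)

lemma N_in_lists: "w \<in> lists S \<Longrightarrow> N w \<in> lists S"
  and length_N: "w \<in> lists S \<Longrightarrow> length (N w) = length w"
  and N_factor: "u \<in> lists S \<Longrightarrow> v \<in> lists S \<Longrightarrow> w \<in> lists S \<Longrightarrow> N (u @ v @ w) = N (u @ N v @ w)"
  using normalisation unfolding normalisation_def by blast+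

lemma N_append_one: "w \<in> lists S \<Longrightarrow> N (w @ [1]) = N w @ [1]"
  and N_Cons_one: "w \<in> lists S \<Longrightarrow> N (1 # w) = N w @ [1]"
  using neutral unfolding neutral_letter_def by blast+

lemma N_idem: "w \<in> lists S \<Longrightarrow> N (N w) = N w"
  using N_factor[of "[]" w "[]"] by simp

abbreviation \<phi> :: "'a \<times> 'a \<Rightarrow> 'a \<times> 'a" where "\<phi> \<equiv> N_bar N"

abbreviation stable :: "'a \<Rightarrow> 'a \<Rightarrow> bool" where
  "stable a b \<equiv> \<phi> (a, b) = (a, b)"

lemma N_pair: "s \<in> S \<Longrightarrow> t \<in> S \<Longrightarrow> N [s, t] = [fst (\<phi> (s, t)), snd (\<phi> (s, t))]"
  using length_N[of "[s, t]"] by (auto simp: N_bar_def length_Suc_conv eval_nat_numeral)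

lemma phi_in: "s \<in> S \<Longrightarrow> t \<in> S \<Longrightarrow> \<phi> (s, t) \<in> S \<times> S"
  using N_in_lists[of "[s, t]"] N_pair[of s t] by (simp add: mem_Times_iff)

lemma phi_one: "s \<in> S \<Longrightarrow> \<phi> (1, s) = (s, 1)"
  using N_Cons_one[of "[s]"] normalisation by (simp add: N_bar_def normalisation_def)

lemma phi_idem: "s \<in> S \<Longrightarrow> t \<in> S \<Longrightarrow> \<phi> (\<phi> (s, t)) = \<phi> (s, t)"
proof -
  assume st: "s \<in> S" "t \<in> S"
  obtain a b where ab: "\<phi> (s, t) = (a, b)" by fastforce
  then have "N [a, b] = [a, b]"
    using N_idem[of "[s, t]"] N_pair[OF st] st by simp
  then show ?thesis by (simp add: ab) (simp add: N_bar_def)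
qed

lemma N_fixed_iff:
  assumes "w \<in> lists S"
  shows "N w = w \<longleftrightarrow> successively stable w"
proof -
  have "successively (\<lambda>s t. N [s, t] = [s, t]) w \<longleftrightarrow> successively stable w"
    using assms by (intro successively_cong) (auto simp: N_pair prod_eq_iff)
  then show ?thesis
    using quadratic assms
    by (simp add: quadratic_normalisation_def all_sublist_pairs_iff_successively)
qed

text \<open>In the normal word \<open>N w\<close> a 1 is followed only by 1, since neutrality gives
  \<open>\<phi> (1, b) = (b, 1)\<close>.\<close>

lemma N_eq:
  assumes "w \<in> lists S"
  shows "N w = removeAll 1 (N w) @ replicate (length w - length (removeAll 1 (N w))) 1"
proof -
  have "successively stable (N w)"
    using N_fixed_iff[OF N_in_lists[OF assms]] N_idem[OF assms] by simp
  then have "successively (\<lambda>a b. a = 1 \<longrightarrow> b = 1) (N w)"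
    using N_in_lists[OF assms] by (elim successively_mono) (auto simp: phi_one)
  then show ?thesis
    using ones_at_end length_N[OF assms] by metis
qed

text \<open>By neutrality 1|v normalises to \<open>N v\<close> followed by 1, and a final 1 splits
  off. This handles the relation 1_S = 1.\<close>

lemma N_insert_one:
  assumes "u \<in> lists S" "v \<in> lists S"
  shows "N (u @ 1 # v) = N (u @ v) @ [1]"
proof -
  have "N (u @ 1 # v) = N (u @ N v @ [1])"
    using N_factor[of u "1 # v" "[]"] assms one_mem by (simp add: N_Cons_one)
  also have "\<dots> = N (u @ N v) @ [1]"
    using N_append_one[of "u @ N v"] assms N_in_lists by simp
  also have "N (u @ N v) = N (u @ v)"
    using N_factor[of u v "[]"] assms by simp
  finally show ?thesis .
qed

text \<open>Both kinds of defining relations preserve \<open>N\<close> up to letters 1; by the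
  presentation this makes the normal form a function of the element of M.\<close>

lemma removeAll_one_N_cong:
  assumes "word_congruence S ({(w, N w) | w. w \<in> lists S} \<union> {([1], [])}) u v"
  shows "removeAll 1 (N u) = removeAll 1 (N v)"
  using assms
proof induction
  case (rel x y u v)
  from rel.hyps(1) consider "y = N x" | "x = [1]" "y = []" by auto
  then show ?case
  proof cases
    case 1
    then show ?thesis using N_factor rel.hyps by simp
  next
    case 2
    then show ?thesis using N_insert_one[of u v] rel.hyps by simp
  qed
qed simp_all

section \<open>Normal forms of elements and the weak domino rule\<close>

lemma word_congruence_iff:
  assumes "u \<in> lists S" "v \<in> lists S"
  shows "word_congruence S ({(w, N w) | w. w \<in> lists S} \<union> {([1], [])}) u v \<longleftrightarrow>
    prod_list u = prod_list v"
  using bspec[OF bspec[OF conjunct2[OF presented[unfolded presented_by_def]] assms(1)] assms(2)]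
  by (rule HOL.sym)

text \<open>The chosen word does not matter, by \<open>removeAll_one_N\<close>.\<close>

definition nf :: "'a \<Rightarrow> 'a list" where
  "nf f = removeAll 1 (N (SOME w. w \<in> lists S \<and> prod_list w = f))"

lemma removeAll_one_N:
  assumes "w \<in> lists S"
  shows "removeAll 1 (N w) = nf (prod_list w)"
proof -
  define v where "v = (SOME v. v \<in> lists S \<and> prod_list v = prod_list w)"
  have "v \<in> lists S \<and> prod_list v = prod_list w"
    unfolding v_def by (rule someI_ex[OF ex_word])
  then have "removeAll 1 (N w) = removeAll 1 (N v)"
    using assms by (intro removeAll_one_N_cong) (simp only: word_congruence_iff)
  then show ?thesis
    by (simp add: nf_def v_def)
qed

lemma prod_list_N:
  assumes "w \<in> lists S"
  shows "prod_list (N w) = prod_list w"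
proof -
  have "word_congruence S ({(w, N w) | w. w \<in> lists S} \<union> {([1], [])}) ([] @ w @ []) ([] @ N w @ [])"
    using assms N_in_lists[OF assms] by (intro word_congruence.rel) auto
  then show ?thesis
    using assms N_in_lists[OF assms] by (simp only: word_congruence_iff append_Nil append_Nil2)
qed

lemma phi_prod: "s \<in> S \<Longrightarrow> t \<in> S \<Longrightarrow> fst (\<phi> (s, t)) * snd (\<phi> (s, t)) = s * t"
  using prod_list_N[of "[s, t]"] by (simp add: N_pair)

text \<open>\<open>N\<close> applied to a shortest word produces no letter 1, as deleting it would
  give a still shorter word. So \<open>nf f\<close> is itself \<open>N\<close>-normal.\<close>

lemma nf_letters: "nf f \<in> lists (S - {1})"
  and prod_list_nf [simp]: "prod_list (nf f) = f"
  and length_nf [simp]: "length (nf f) = len f"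
  and successively_stable_nf: "successively stable (nf f)"
proof -
  obtain w where w: "w \<in> lists S" "prod_list w = f" "length w = len f"
    using ex_shortest_word by blast
  then have nf: "nf f = removeAll 1 (N w)"
    using removeAll_one_N by simp
  then show letters: "nf f \<in> lists (S - {1})" and f: "prod_list (nf f) = f"
    using N_in_lists[OF w(1)] w prod_list_N by auto
  have "length (nf f) \<le> len f"
    unfolding nf using length_removeAll_less_eq[of 1 "N w"] length_N w by simp
  moreover have "len f \<le> length (nf f)"
    using len_prod_list_le[of "nf f"] letters f by auto
  ultimately show len: "length (nf f) = len f" by simp
  then have "nf f = N w"
    using N_eq[OF w(1)] w(3) nf by simp
  then show "successively stable (nf f)"
    using N_fixed_iff N_in_lists N_idem w(1) by metis
qed

lemma nf_in_lists: "nf f \<in> lists S" and one_notin_nf: "1 \<notin> set (nf f)"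
  using nf_letters[of f] by auto

lemma nf_one [simp]: "nf 1 = []"
  using length_nf[of 1] by (simp del: length_nf)

lemma nf_stable_word:
  assumes "w \<in> lists (S - {1})" "successively stable w"
  shows "nf (prod_list w) = w"
proof -
  have w: "w \<in> lists S" "1 \<notin> set w" using assms by auto
  then have "N w = w" using N_fixed_iff assms by simp
  then show ?thesis
    using removeAll_one_N[OF w(1)] w(2) by (simp add: removeAll_id)
qed

text \<open>Here the weak domino rule enters: applied at two consecutive positions of the sweep, it
  makes the two letters produced there stable.\<close>

lemma successively_stable_T_phi:
  assumes "s \<in> S" "w \<in> lists S" "successively stable w" "1 \<notin> set (T_phi \<phi> (s # w))"
  shows "successively stable (T_phi \<phi> (s # w))"
  using assms
proof (induction w arbitrary: s)
  case (Cons x w)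
  define y t where "y = fst (\<phi> (s, x))" and "t = snd (\<phi> (s, x))"
  have yt: "\<phi> (s, x) = (y, t)" "y \<in> S" "t \<in> S" "stable y t"
    using phi_in[of s x] phi_idem[of s x] Cons.prems
    by (auto simp: y_def t_def mem_Times_iff)
  have T: "T_phi \<phi> (s # x # w) = y # T_phi \<phi> (t # w)"
    by (simp add: yt)
  show ?case
  proof (cases w)
    case Nil
    then show ?thesis using T yt by simp
  next
    case (Cons x2 v)
    define y2 t2 where "y2 = fst (\<phi> (t, x2))" and "t2 = snd (\<phi> (t, x2))"
    have yt2: "\<phi> (t, x2) = (y2, t2)" "y2 \<in> S" "t2 \<in> S" "stable y2 t2"
      using phi_in[of t x2] phi_idem[of t x2] Cons.prems Cons yt
      by (auto simp: y2_def t2_def mem_Times_iff)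
    have T2: "T_phi \<phi> (t # w) = y2 # T_phi \<phi> (t2 # v)"
      using Cons yt2 by simp
    have IH: "successively stable (T_phi \<phi> (t # w))"
      using Cons.prems Cons yt T by (intro Cons.IH) auto
    \<comment> \<open>\<open>t2\<close> = 1 would be carried to the end of the sweep.\<close>
    have ne: "y \<noteq> 1" "y2 \<noteq> 1" "t2 \<noteq> 1"
      using Cons.prems Cons T T2 T_phi_one_Cons[OF phi_one, of v] by auto
    have "stable x x2" "x \<in> S" "x2 \<in> S"
      using Cons.prems Cons by auto
    \<comment> \<open>The rule with s0 = \<open>s\<close>, r1 = \<open>x\<close>, r2 =
      \<open>x2\<close>, carries s1 = \<open>t\<close>, s2 = \<open>t2\<close> and outputs r1' =
      \<open>y\<close>, r2' = \<open>y2\<close>.\<close>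
    then have "stable y y2"
      using weak_domino Cons.prems(1) yt yt2 ne unfolding weak_domino_rule_def by blast
    then show ?thesis using T T2 IH by simp
  qed
qed simp

lemma T_phi_nf:
  assumes "s \<in> S - {1}" "1 \<notin> set (T_phi \<phi> (s # nf f))"
  shows "T_phi \<phi> (s # nf f) = nf (s * f)"
proof -
  have sf: "s # nf f \<in> lists S" using assms nf_in_lists by simp
  have "T_phi \<phi> (s # nf f) \<in> lists S"
    using T_phi_lists[of \<phi>, OF phi_in sf] .
  then have "nf (prod_list (T_phi \<phi> (s # nf f))) = T_phi \<phi> (s # nf f)"
    using assms nf_in_lists successively_stable_nf
    by (intro nf_stable_word successively_stable_T_phi) auto
  then show ?thesis
    using prod_list_T_phi[of \<phi>, OF phi_in phi_prod sf] by simp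
qed

lemma N_phi_eq_nf: "w \<in> lists S \<Longrightarrow> N_phi \<phi> w = nf (prod_list w)"
  by (rule N_phi_eqI[of \<phi> nf, OF phi_in phi_prod nf_in_lists prod_list_nf nf_one T_phi_nf]) auto

text \<open>The sweep is a word of \<open>Suc (len f)\<close> letters for s f, and a 1 in it could
  be deleted. Thus absence of 1 becomes a condition on lengths.\<close>

lemma T_phi_nf_reduced_iff:
  assumes "s \<in> S - {1}"
  shows "1 \<notin> set (T_phi \<phi> (s # nf f)) \<longleftrightarrow> len (s * f) = Suc (len f)"
proof
  assume "1 \<notin> set (T_phi \<phi> (s # nf f))"
  then have "T_phi \<phi> (s # nf f) = nf (s * f)" by (rule T_phi_nf[OF assms])
  then show "len (s * f) = Suc (len f)"
    by (metis length_Cons length_T_phi length_nf)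
next
  assume len: "len (s * f) = Suc (len f)"
  let ?T = "T_phi \<phi> (s # nf f)"
  have sf: "s # nf f \<in> lists S" using assms nf_in_lists by simp
  have "removeAll 1 ?T \<in> lists S" "prod_list (removeAll 1 ?T) = s * f"
    using T_phi_lists[of \<phi>, OF phi_in sf] prod_list_T_phi[of \<phi>, OF phi_in phi_prod sf] by auto
  then have "len (s * f) \<le> length (removeAll 1 ?T)"
    using len_prod_list_le by metis
  then show "1 \<notin> set ?T"
    using length_removeAll_less[of 1 ?T] len by auto
qed

section \<open>The factorisation map of a normalisation\<close>

abbreviation \<eta> :: "'a \<Rightarrow> 'a \<times> 'a" where "\<eta> \<equiv> eta_of_N S N"

lemma eta_one [simp]: "\<eta> 1 = (1, 1)"
  by (simp add: eta_of_N_def)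

lemma eta_eq:
  assumes "f \<noteq> 1"
  shows "\<eta> f = (hd (nf f), prod_list (tl (nf f)))"
proof -
  define w where "w = (SOME w. w \<in> lists S \<and> prod_list w = f)"
  have "w \<in> lists S \<and> prod_list w = f"
    unfolding w_def by (rule someI_ex[OF ex_word])
  then show ?thesis
    using assms N_phi_eq_nf by (simp add: eta_of_N_def w_def[symmetric] Let_def)
qed

text \<open>Stability passes to the tail, which is therefore the normal form of its product.\<close>

lemma nf_rec:
  assumes "f \<noteq> 1"
  shows "nf f = fst (\<eta> f) # nf (snd (\<eta> f))"
proof -
  obtain x w where xw: "nf f = x # w"
    using assms length_nf[of f] by (cases "nf f") (auto simp del: length_nf)
  then have "nf (prod_list w) = w"
    using nf_letters[of f] successively_stable_nf[of f]
    by (intro nf_stable_word) (auto simp: successively_Cons)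
  then show ?thesis
    using xw assms by (simp add: eta_eq)
qed

lemma eta_prod [simp]: "fst (\<eta> f) * snd (\<eta> f) = f"
proof (cases "f = 1")
  case False
  have "f = prod_list (nf f)" by simp
  also have "\<dots> = fst (\<eta> f) * snd (\<eta> f)"
    unfolding nf_rec[OF False] by simp
  finally show ?thesis by simp
qed simp

lemma fst_eta: "f \<noteq> 1 \<Longrightarrow> fst (\<eta> f) \<in> S - {1}"
  using nf_rec[of f] nf_letters[of f] by simp

lemma len_snd_eta: "f \<noteq> 1 \<Longrightarrow> len f = Suc (len (snd (\<eta> f)))"
  using nf_rec[of f] by (metis length_Cons length_nf)

lemma len_eta: "len (fst (\<eta> f)) + len (snd (\<eta> f)) = len f"
  using len_snd_eta[of f] fst_eta[of f] by (cases "f = 1") auto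

lemma eta_letter: "s \<in> S \<Longrightarrow> \<eta> s = (s, 1)"
proof (cases "s = 1")
  case False
  assume "s \<in> S"
  then have "nf s = [s]"
    using nf_stable_word[of "[s]"] False by simp
  then show ?thesis by (simp add: eta_eq False)
qed simp

lemma phi_eq_eta:
  assumes "s \<in> S" "t \<in> S"
  shows "\<phi> (s, t) = \<eta> (s * t)"
proof -
  obtain a b where ab: "\<phi> (s, t) = (a, b)" by fastforce
  then have N: "N [s, t] = [a, b]"
    using assms by (simp add: N_pair)
  have prod: "a * b = s * t" using phi_prod[OF assms] ab by simp
  have nf: "nf (s * t) = removeAll 1 [a, b]"
    using removeAll_one_N[of "[s, t]"] assms N by simp
  \<comment> \<open>Letters 1 come last, so \<open>removeAll\<close> loses no information about the
    pair.\<close>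
  have "a = 1 \<longrightarrow> b = 1"
    using N_eq[of "[s, t]"] assms unfolding N by (auto split: if_splits)
  then show ?thesis
    using nf ab prod by (cases "s * t = 1") (auto simp: eta_eq split: if_splits)
qed

lemma factorisation_map_eta: "factorisation_map S \<eta>"
  unfolding factorisation_map_def
  by (intro conjI allI impI eta_one eta_prod len_eta[symmetric] fst_eta)

lemma stable_fst_eta:
  "\<eta> (fst (\<eta> f) * fst (\<eta> (snd (\<eta> f)))) = (fst (\<eta> f), fst (\<eta> (snd (\<eta> f))))"
proof (cases "f = 1 \<or> snd (\<eta> f) = 1")
  case True
  then show ?thesis
    using fst_eta[of f] eta_letter[of "fst (\<eta> f)"] by (cases "f = 1") auto
next
  case False
  then have "stable (fst (\<eta> f)) (fst (\<eta> (snd (\<eta> f))))"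
    using successively_stable_nf[of f] by (simp add: nf_rec)
  moreover have "fst (\<eta> f) \<in> S" "fst (\<eta> (snd (\<eta> f))) \<in> S"
    using False fst_eta by auto
  ultimately show ?thesis using phi_eq_eta by simp
qed

section \<open>\<open>\<eta>\<close> on products of additive length\<close>

lemma T_phi_nf_rec:
  assumes "s \<in> S" "f \<noteq> 1"
  shows "T_phi \<phi> (s # nf f) = fst (\<eta> (s * fst (\<eta> f))) #
    T_phi \<phi> (snd (\<eta> (s * fst (\<eta> f))) # nf (snd (\<eta> f)))"
  using assms fst_eta[of f] by (simp add: nf_rec phi_eq_eta)

text \<open>The letter case of \<open>eta_mult\<close>. Without loss of length the sweep is the
  normal form of s f; its first step gives the letter, and the product of the rest is the
  remainder.\<close>

lemma eta_letter_mult: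
  assumes "s \<in> S - {1}" "len (s * f) = Suc (len f)"
  shows "\<eta> (s * f) = (fst (\<eta> (s * fst (\<eta> f))), snd (\<eta> (s * fst (\<eta> f))) * snd (\<eta> f))"
proof (cases "f = 1")
  case True
  then show ?thesis by simp
next
  case False
  define p where "p = \<eta> (s * fst (\<eta> f))"
  have "nf (s * f) = T_phi \<phi> (s # nf f)"
    using T_phi_nf[OF assms(1)] T_phi_nf_reduced_iff[OF assms(1)] assms(2) by simp
  then have nf: "nf (s * f) = fst p # T_phi \<phi> (snd p # nf (snd (\<eta> f)))"
    using T_phi_nf_rec[of s f] assms(1) False by (simp add: p_def)
  have "snd p \<in> S"
    using phi_in[of s "fst (\<eta> f)"] phi_eq_eta[of s "fst (\<eta> f)"] assms(1) fst_eta[OF False]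
    by (simp add: p_def mem_Times_iff)
  then have "prod_list (T_phi \<phi> (snd p # nf (snd (\<eta> f)))) = snd p * snd (\<eta> f)"
    using prod_list_T_phi[of \<phi> "snd p # nf (snd (\<eta> f))", OF phi_in phi_prod] nf_in_lists by simp
  moreover have "s * f \<noteq> 1" using assms(2) by auto
  ultimately show ?thesis
    using nf by (simp add: eta_eq[of "s * f"] p_def)
qed

text \<open>The length conditions on the first step and on the rest of the sweep exclude a 1 in
  either part.\<close>

lemma len_letter_mult:
  assumes "s \<in> S - {1}" "len (s * fst (\<eta> f)) = 2"
    and "len (snd (\<eta> (s * fst (\<eta> f))) * snd (\<eta> f)) = Suc (len (snd (\<eta> f)))"
  shows "len (s * f) = Suc (len f)"
proof (cases "f = 1")
  case True
  then show ?thesis using assms(1) by simp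
next
  case False
  define p where "p = \<eta> (s * fst (\<eta> f))"
  have "s * fst (\<eta> f) \<noteq> 1" using assms(2) by auto
  then have p: "fst p \<noteq> 1" "len (snd p) = 1"
    using fst_eta len_snd_eta assms(2) by (fastforce simp: p_def)+
  then have "snd p \<in> S - {1}"
    using letter_if_len_le_1[of "snd p"] by auto
  then have "1 \<notin> set (T_phi \<phi> (snd p # nf (snd (\<eta> f))))"
    using T_phi_nf_reduced_iff assms(3) p_def by blast
  then have "1 \<notin> set (T_phi \<phi> (s # nf f))"
    using p T_phi_nf_rec[of s f] assms(1) False by (simp add: p_def)
  then show ?thesis using T_phi_nf_reduced_iff assms(1) by blast
qed

lemma eta_induct [case_names one mult]:
  assumes "P 1" and "\<And>f. f \<noteq> 1 \<Longrightarrow> P (snd (\<eta> f)) \<Longrightarrow> P f"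
  shows "P f"
  by (induction f rule: measure_induct_rule[of len]) (metis assms len_snd_eta lessI)

lemma len_fst_eta: "f \<noteq> 1 \<Longrightarrow> len (fst (\<eta> f)) = 1"
  using fst_eta[of f] by simp

text \<open>Writes a = s b and applies the letter case to s (b f) and to s (b x), x being the first
  letter of f. By the induction hypothesis b f and b x have the same first letter, so both
  computations share their first step.\<close>

lemma eta_mult:
  assumes "len (a * f) = len a + len f"
  shows "\<eta> (a * f) = (fst (\<eta> (a * fst (\<eta> f))), snd (\<eta> (a * fst (\<eta> f))) * snd (\<eta> f))"
  using assms
proof (induction a rule: eta_induct)
  case one
  show ?case
    using fst_eta[of f] by (cases "f = 1") (auto simp: eta_letter)
next
  case (mult a)
  define s b where "s = fst (\<eta> a)" and "b = snd (\<eta> a)"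
  define x g where "x = fst (\<eta> f)" and "g = snd (\<eta> f)"
  have s: "s \<in> S - {1}" and len_a: "len a = Suc (len b)" and a: "a = s * b" and f: "f = x * g"
    using mult.hyps fst_eta len_snd_eta by (auto simp: s_def b_def x_def g_def)
  \<comment> \<open>No length is lost in a f, so by subadditivity none is lost in b f and s (b
    f).\<close>
  have "len (a * f) \<le> len s + len (b * f)"
    using len_mult_le[of s "b * f"] by (simp add: a mult.assoc)
  then have bf: "len (b * f) = len b + len f" and sbf: "len (s * (b * f)) = Suc (len (b * f))"
    using mult.prems s len_a len_mult_le[of b f] by (auto simp: a mult.assoc)
  have lf: "len f = len x + len g"
    using len_eta[of f] by (simp add: x_def g_def)
  have "len (a * f) \<le> len (a * x) + len g"
    using len_mult_le[of "a * x" g] by (simp add: f mult.assoc)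
  then have "len a + len x \<le> len (s * (b * x))"
    using mult.prems lf by (simp add: a mult.assoc)
  moreover have "len (s * (b * x)) \<le> Suc (len (b * x))" "len (b * x) \<le> len b + len x"
    using len_mult_le[of s "b * x"] len_mult_le[of b x] s by auto
  ultimately have sbx: "len (s * (b * x)) = Suc (len (b * x))"
    using len_a by simp
  have "\<eta> (b * f) = (fst (\<eta> (b * x)), snd (\<eta> (b * x)) * g)"
    using mult.IH bf by (simp add: b_def x_def g_def)
  then show ?case
    using eta_letter_mult[OF s sbf] eta_letter_mult[OF s sbx]
    by (simp add: a mult.assoc flip: x_def g_def)
qed

text \<open>Induction on a = s b: the conditions pass to b, then \<open>eta_mult\<close> identifies
  \<open>\<eta> (b * f)\<close>, and \<open>len_letter_mult\<close> adds the letter s.\<close>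

lemma len_mult_eqI:
  assumes "len (a * fst (\<eta> f)) = len a + len (fst (\<eta> f))"
    and "len (snd (\<eta> (a * fst (\<eta> f))) * snd (\<eta> f)) =
      len (snd (\<eta> (a * fst (\<eta> f)))) + len (snd (\<eta> f))"
  shows "len (a * f) = len a + len f"
proof (cases "f = 1")
  case True
  then show ?thesis by simp
next
  case False
  define x g where "x = fst (\<eta> f)" and "g = snd (\<eta> f)"
  have x: "x \<in> S - {1}" "len x = 1" and len_f: "len f = Suc (len g)" and f: "f = x * g"
    using False fst_eta len_snd_eta len_fst_eta by (auto simp: x_def g_def)
  show ?thesis
    using assms unfolding x_def[symmetric] g_def[symmetric]
  proof (induction a rule: eta_induct)
    case one
    then show ?case by simp
  next
    case (mult a)
    define s b where "s = fst (\<eta> a)" and "b = snd (\<eta> a)"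
    define p q where "p = fst (\<eta> (b * x))" and "q = snd (\<eta> (b * x))"
    define t where "t = snd (\<eta> (s * p))"
    have s: "s \<in> S - {1}" "len s = 1" and len_a: "len a = Suc (len b)" and a: "a = s * b"
      using mult.hyps fst_eta len_snd_eta len_fst_eta by (auto simp: s_def b_def)
    have "len (s * (b * x)) = Suc (len b) + 1"
      using mult.prems(1) x by (simp add: a[symmetric] len_a flip: mult.assoc)
    then have bx: "len (b * x) = Suc (len b)" and sbx: "len (s * (b * x)) = Suc (len (b * x))"
      using len_mult_le[of s "b * x"] len_mult_le[of b x] x s by auto
    have ne: "b * x \<noteq> 1" using bx by auto
    have p: "p \<in> S - {1}" "len p = 1" "len q = len b"
      using fst_eta[OF ne] len_fst_eta[OF ne] len_snd_eta[OF ne] bx by (auto simp: p_def q_def)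
    have "\<eta> (a * x) = (fst (\<eta> (s * p)), t * q)"
      using eta_letter_mult[OF s(1) sbx] by (simp add: a mult.assoc p_def q_def t_def)
    moreover have "len (a * x) = Suc (Suc (len b))"
      using mult.prems(1) x len_a by simp
    moreover have "a * x \<noteq> 1" using calculation(2) by auto
    ultimately have tq: "len (t * q) = Suc (len b)" "len ((t * q) * g) = Suc (len b) + len g"
      using len_snd_eta[of "a * x"] mult.prems(2) by auto
    have "len t \<le> 1"
      using len_eta[of "s * p"] len_mult_le[of s p] s p fst_eta[of "s * p"]
      by (cases "s * p = 1") (auto simp: t_def)
    \<comment> \<open>Each factor attains its maximal length, since \<open>t q g\<close> has length
      1 + \<open>len q\<close> + \<open>len g\<close>.\<close>
    then have t: "len t = 1" and qg: "len (q * g) = len q + len g"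
      and tqg: "len (t * (q * g)) = Suc (len (q * g))"
      using len_mult_le[of t q] len_mult_le[of t "q * g"] len_mult_le[of q g] tq p
      by (auto simp: mult.assoc)
    have bf: "len (b * f) = len b + len f"
      using mult.IH bx x qg by (simp add: b_def[symmetric] q_def)
    then have eta_bf: "\<eta> (b * f) = (p, q * g)"
      using eta_mult by (simp add: p_def q_def x_def g_def)
    have "s * p \<noteq> 1" using t by (auto simp: t_def)
    then have "len (s * p) = 2"
      using len_snd_eta[of "s * p"] t by (simp add: t_def)
    then have "len (s * (b * f)) = Suc (len (b * f))"
      using len_letter_mult[OF s(1), of "b * f"] eta_bf tqg by (simp add: t_def)
    then show ?case using bf len_a by (simp add: a mult.assoc)
  qed
qed

section \<open>The factorability axiom\<close>

lemmas F_simps = apply2_at_def mult_pair_def total_length_def case_prod_unfold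

text \<open>\<open>F2 F1 F2\<close> forms b c, then a x, then r g. In the additive case
  \<open>eta_mult\<close> evaluates it; if none of the three products loses length, a b c does not
  either, by \<open>len_mult_eqI\<close>.\<close>

lemma F2F1F2_triple:
  fixes a b c :: 'a
  defines "t \<equiv> apply2_at (\<eta> \<circ> mult_pair) 2 (apply2_at (\<eta> \<circ> mult_pair) 1
    (apply2_at (\<eta> \<circ> mult_pair) 2 [a, b, c]))"
  shows "len (a * b * c) = len a + len b + len c \<Longrightarrow>
      t = [fst (\<eta> (a * b * c)), fst (\<eta> (snd (\<eta> (a * b * c)))), snd (\<eta> (snd (\<eta> (a * b * c))))]"
    and "len (a * b * c) < len a + len b + len c \<Longrightarrow>
      total_length S t < len a + len b + len c"
proof -
  define x g where "x = fst (\<eta> (b * c))" and "g = snd (\<eta> (b * c))"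
  define y r where "y = fst (\<eta> (a * x))" and "r = snd (\<eta> (a * x))"
  have t: "t = [y, fst (\<eta> (r * g)), snd (\<eta> (r * g))]"
    by (simp add: t_def F_simps x_def g_def y_def r_def)
  have bc: "len (b * c) = len x + len g"
    using len_eta[of "b * c"] by (simp add: x_def g_def)
  have ax: "len (a * x) = len y + len r"
    using len_eta[of "a * x"] by (simp add: y_def r_def)
  have le: "len (b * c) \<le> len b + len c" "len (a * x) \<le> len a + len x" "len (r * g) \<le> len r + len g"
    "len (a * b * c) \<le> len a + len (b * c)"
    using len_mult_le[of a "b * c"] by (auto simp: len_mult_le mult.assoc)
  {
    assume "len (a * b * c) = len a + len b + len c"
    then have "len (a * (b * c)) = len a + len (b * c)"
      using le by (simp add: mult.assoc)
    from eta_mult[OF this] have "\<eta> (a * b * c) = (y, r * g)"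
      by (simp add: x_def g_def y_def r_def mult.assoc)
    then show "t = [fst (\<eta> (a * b * c)), fst (\<eta> (snd (\<eta> (a * b * c)))),
        snd (\<eta> (snd (\<eta> (a * b * c))))]"
      using t by simp
  next
    assume less: "len (a * b * c) < len a + len b + len c"
    have total: "total_length S t = len y + len (r * g)"
      using len_eta[of "r * g"] by (simp add: t total_length_def)
    show "total_length S t < len a + len b + len c"
    proof (rule ccontr)
      assume "\<not> ?thesis"
      \<comment> \<open>No step increases the total length, so equality holds at each of
        them.\<close>
      then have "len (b * c) = len b + len c" "len (a * x) = len a + len x"
        "len (r * g) = len r + len g"
        using le total ax bc by linarith+
      then have "len (a * (b * c)) = len a + len b + len c"
        using len_mult_eqI[of a "b * c"] by (simp add: x_def g_def r_def)
      then show False using less by (simp add: mult.assoc)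
    qed
  }
qed

text \<open>\<open>F2 F1 F2 F1\<close> is \<open>F2 F1 F2\<close> on \<open>[u, v, c]\<close>, a
  triple with the same product, so \<open>F2F1F2_triple\<close> covers it too. The outermost
  \<open>F1\<close> in \<open>F1 F2 F1 F2\<close> fixes the first two letters of a normal form and
  never increases length.\<close>

lemma factorability_eta: "factorability_structure S \<eta>"
  unfolding factorability_structure_def
proof (intro conjI factorisation_map_eta allI)
  fix a b c :: 'a
  define F1 F2 where "F1 = apply2_at (\<eta> \<circ> mult_pair) 1" and "F2 = apply2_at (\<eta> \<circ> mult_pair) 2"
  note F = F1_def F2_def
  define u v where "u = fst (\<eta> (a * b))" and "v = snd (\<eta> (a * b))"
  define n where "n = len a + len b + len c"
  have F1: "F1 [a, b, c] = [u, v, c]"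
    by (simp add: F F_simps u_def v_def)
  have uv: "u * v = a * b" "len u + len v = len (a * b)"
    by (simp_all add: u_def v_def len_eta)
  have ab: "len (a * b) \<le> len a + len b" "len (a * b * c) \<le> len (a * b) + len c"
    by (rule len_mult_le)+
  have le1: "total_length S (F1 w) \<le> total_length S w" if "length w = 3" for w
    using that len_mult_le len_eta
    by (auto simp: F F_simps eval_nat_numeral length_Suc_conv)
  have n: "total_length S [a, b, c] = n" by (simp add: n_def total_length_def)
  have "(F1 (F2 (F1 (F2 [a, b, c]))) = F2 (F1 (F2 [a, b, c])) \<and>
      F2 (F1 (F2 [a, b, c])) = F2 (F1 (F2 (F1 [a, b, c])))) \<or>
    (total_length S (F1 (F2 (F1 (F2 [a, b, c])))) < n \<and>
     total_length S (F2 (F1 (F2 [a, b, c]))) < n \<and>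
     total_length S (F2 (F1 (F2 (F1 [a, b, c])))) < n)"
  proof (cases "len (a * b * c) = n")
    case True
    then have "F2 (F1 (F2 [a, b, c])) = F2 (F1 (F2 [u, v, c]))"
      using F2F1F2_triple(1)[of a b c] F2F1F2_triple(1)[of u v c] uv ab
      by (simp add: F n_def)
    moreover have "F1 (F2 (F1 (F2 [a, b, c]))) = F2 (F1 (F2 [a, b, c]))"
      using F2F1F2_triple(1)[of a b c] True stable_fst_eta[of "a * b * c"]
      unfolding F n_def by (simp add: F_simps)
    ultimately show ?thesis using F1 by simp
  next
    case False
    then have less: "len (a * b * c) < n" using ab by (simp add: n_def)
    then have 1: "total_length S (F2 (F1 (F2 [a, b, c]))) < n"
      using F2F1F2_triple(2)[of a b c] by (simp add: F n_def)
    have "length (F2 (F1 (F2 [a, b, c]))) = 3"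
      by (simp add: F F_simps)
    then have 2: "total_length S (F1 (F2 (F1 (F2 [a, b, c])))) < n"
      using le1 1 le_less_trans by blast
    \<comment> \<open>If \<open>[u, v, c]\<close> is additive, the length was already lost in
      passing to it; otherwise \<open>F2 F1 F2\<close> loses some.\<close>
    have "total_length S (F2 (F1 (F2 [u, v, c]))) < n"
    proof (cases "len (u * v * c) = len u + len v + len c")
      case True
      then have "total_length S (F2 (F1 (F2 [u, v, c]))) = len (a * b * c)"
        using F2F1F2_triple(1)[OF True] len_eta[of "a * b * c"] len_eta[of "snd (\<eta> (a * b * c))"]
        unfolding F by (simp add: uv total_length_def)
      then show ?thesis using less by simp
    next
      case False
      then have "total_length S (F2 (F1 (F2 [u, v, c]))) < len u + len v + len c"
        using F2F1F2_triple(2)[of u v c] len_mult_le[of "u * v" c] uv by (simp add: F)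
      then show ?thesis using uv ab by (simp add: n_def)
    qed
    then show ?thesis using 1 2 F1 by simp
  qed
  then show "let t = [a, b, c]; F1 = apply2_at (\<eta> \<circ> mult_pair) 1; F2 = apply2_at (\<eta> \<circ> mult_pair) 2;
      x = F1 (F2 (F1 (F2 t))); y = F2 (F1 (F2 t)); z = F2 (F1 (F2 (F1 t)))
    in x = y \<and> y = z \<or>
       total_length S x < total_length S t \<and>
       total_length S y < total_length S t \<and>
       total_length S z < total_length S t"
    unfolding Let_def F1_def[symmetric] F2_def[symmetric] n .
qed

section \<open>Well-definedness of \<open>\<eta>\<close> and recovery of \<open>N\<close>\<close>

lemma eta_well_defined: "eta_of_N_well_defined S N"
  unfolding eta_of_N_well_defined_def using N_phi_eq_nf nf_rec by auto

text \<open>Both normal forms satisfy the same recursion along \<open>\<eta>\<close> and hence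
  agree; \<open>N w\<close> is the normal form padded to the length of w.\<close>

lemma N_of_eta_eq:
  assumes "w \<in> lists S"
  shows "N_of_eta S \<eta> w = N w"
proof -
  interpret E: factorable_monoid S \<eta>
    by unfold_locales (rule factorability_eta)
  have "E.nf f = nf f" for f
    by (induction f rule: eta_induct) (simp_all add: E.nf_rec nf_rec)
  then have "N_of_eta S \<eta> w = nf (prod_list w) @ replicate (length w - len (prod_list w)) 1"
    using E.N_eq[OF assms] by simp
  then show ?thesis
    using N_eq[OF assms] removeAll_one_N[OF assms] by simp
qed

end


theorem corollary4p1p12:
  fixes S :: "'a::monoid_mult set"
  assumes "prod_list ` lists S = UNIV" and "1 \<in> S"
  shows
    "((\<forall>\<eta>. factorability_structure S \<eta> \<longrightarrow>
         phi_of_eta S \<eta> \<in> S \<times> S \<rightarrow> S \<times> S \<and>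
         weak_domino_normalisation S (N_of_eta S \<eta>)) \<and>
      (\<forall>N. weak_domino_normalisation S N \<longrightarrow>
         eta_of_N_well_defined S N \<and>
         factorability_structure S (eta_of_N S N)) \<and>
      (\<forall>\<eta>. factorability_structure S \<eta> \<longrightarrow> eta_of_N S (N_of_eta S \<eta>) = \<eta>) \<and>
      (\<forall>N. weak_domino_normalisation S N \<longrightarrow>
         (\<forall>w\<in>lists S. N_of_eta S (eta_of_N S N) w = N w))) \<and>
     (\<forall>\<eta>. factorability_structure S \<eta> \<longrightarrow>
        (\<forall>f. \<forall>w\<in>lists S. prod_list w = f \<longrightarrow>
           eta_nf S \<eta> f = removeAll 1 (N_of_eta S \<eta> w))) \<and>
     (\<forall>\<eta>. factorability_structure S \<eta> \<longrightarrow>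
        eta_rules S \<eta> =
          {(removeAll 1 u, removeAll 1 v) | u v.
             (u, v) \<in> normalisation_rules S (N_of_eta S \<eta>) \<and> removeAll 1 u \<noteq> removeAll 1 v})"
proof -
  interpret generated_monoid S
    by unfold_locales (fact assms)+
  have F: "factorable_monoid S \<eta>" if "factorability_structure S \<eta>" for \<eta>
    using that by unfold_locales
  have W: "weak_domino_monoid S N" if "weak_domino_normalisation S N" for N
    using that by unfold_locales
  show ?thesis
    by (intro conjI allI impI ballI)
      (auto simp only: factorable_monoid.phi_of_eta_funcset[OF F]
        factorable_monoid.weak_domino_normalisation_N[OF F]
        weak_domino_monoid.eta_well_defined[OF W] weak_domino_monoid.factorability_eta[OF W]
        factorable_monoid.eta_of_N_eq[OF F] weak_domino_monoid.N_of_eta_eq[OF W]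
        factorable_monoid.removeAll_one_N[OF F] factorable_monoid.eta_rules_eq[OF F])
qed

end
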